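(* Let $E$ be a separable Banach space over $\mathbb{K}\in\{\mathbb{R},\mathbb{C}\}$. Assume that $E$ is weakly sequentially complete and that $E$ has a besselian Schauder frame. Then $E$ is isometrically isomorphic to a complemented subspace of a Banach space $W$ which has an unconditional Schauder basis.
   Context: All Banach spaces are over the same field $\mathbb{K}$. Let $X$ be a Banach space with dual $X^*$, and let $\mathbb{I}$ be either $\mathbb{N}^*=\{1,2,3,\dots\}$ or $\{1,\dots,r\}$ for some $r\in\mathbb{N}^*$. A Schauder frame of $X$ is a sequence $((x_n,y_n^* ))_{n\in\mathbb{I}}$ of elements of $X\times X^*$ such that for every $x\in X$ one has $\sum_{n\in\mathbb{I}} y_n^*(x)x_n=x$ (when $\mathbb{I}=\mathbb{N}^*$: the series $\sum y_n^*(x)x_n$ converges in the norm of $X$ to $x$). It is a besselian Schauder frame if moreover there is a constant $A>0$ such that $\sum_{n\in\mathbb{I}}|y_n^*(x)|\,|y^*(x_n)|\le A\|x\|_X\|y^*\|_{X^*}$ for all $(x,y^* )\in X\times X^*$. The space $X$ is weakly sequentially complete if for each sequence $(x_n)_{n\in\mathbb{N}^*}$ of $X$ such that $\lim_{n\to\infty}y^*(x_n)$ exists for every $y^*\in X^*$, there exists $x\in X$ with $\lim_{n\to\infty}y^*(x_n)=y^*(x)$ for every $y^*\in X^*$. A subspace is complemented if it is the range of a bounded linear projection (in particular it is closed). In a finite-dimensional space an algebraic basis counts as an unconditional Schauder basis. *)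

theory Defs
  imports "HOL-Analysis.Analysis" "HOL-Library.Function_Algebras"
begin

(* HOL-Analysis has no class of complex normed spaces, and a Banach space whose existence is
   asserted cannot be a type.  Hence normed spaces over a field 'k (real or complex below) are
   records, whose carrier is a linear subspace of an ambient vector space 'a over 'k. *)

record ('k, 'a) nspace =
  vecs :: "'a set"
  smul :: "'k \<Rightarrow> 'a \<Rightarrow> 'a"
  nrm :: "'a \<Rightarrow> real"

definition normed_space :: "('k::real_normed_field, 'a::ab_group_add) nspace \<Rightarrow> bool" where
  "normed_space E \<longleftrightarrow>
     vector_space (smul E) \<and> module.subspace (smul E) (vecs E) \<and>
     (\<forall>x\<in>vecs E. 0 \<le> nrm E x) \<and>
     (\<forall>x\<in>vecs E. nrm E x = 0 \<longleftrightarrow> x = 0) \<and>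
     (\<forall>c. \<forall>x\<in>vecs E. nrm E (smul E c x) = norm c * nrm E x) \<and>
     (\<forall>x\<in>vecs E. \<forall>y\<in>vecs E. nrm E (x + y) \<le> nrm E x + nrm E y)"

(* nrm is unconstrained outside the carrier, whereas the locale Metric_space demands
   nonnegativity and symmetry everywhere; hence the value 0 there. *)
definition ndist :: "('k, 'a::ab_group_add) nspace \<Rightarrow> 'a \<Rightarrow> 'a \<Rightarrow> real" where
  "ndist E x y = (if x \<in> vecs E \<and> y \<in> vecs E then nrm E (x - y) else 0)"

abbreviation ntopology :: "('k, 'a::ab_group_add) nspace \<Rightarrow> 'a topology" where
  "ntopology E \<equiv> Metric_space.mtopology (vecs E) (ndist E)"

definition banach_space :: "('k::real_normed_field, 'a::ab_group_add) nspace \<Rightarrow> bool" where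
  "banach_space E \<longleftrightarrow> normed_space E \<and> Metric_space.mcomplete (vecs E) (ndist E)"

definition bounded_operator ::
  "('k, 'a::ab_group_add) nspace \<Rightarrow> ('k, 'b::ab_group_add) nspace \<Rightarrow> ('a \<Rightarrow> 'b) \<Rightarrow> bool" where
  "bounded_operator E F T \<longleftrightarrow>
     T ` vecs E \<subseteq> vecs F \<and>
     (\<forall>x\<in>vecs E. \<forall>y\<in>vecs E. T (x + y) = T x + T y) \<and>
     (\<forall>c. \<forall>x\<in>vecs E. T (smul E c x) = smul F c (T x)) \<and>
     (\<exists>B. \<forall>x\<in>vecs E. nrm F (T x) \<le> B * nrm E x)"

definition scalars :: "('k::real_normed_field, 'k) nspace" where
  "scalars = \<lparr>vecs = UNIV, smul = (*), nrm = norm\<rparr>"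

(* Only the values of a functional on the carrier are relevant. *)
definition dual :: "('k::real_normed_field, 'a::ab_group_add) nspace \<Rightarrow> ('a \<Rightarrow> 'k) set" where
  "dual E = {f. bounded_operator E scalars f}"

definition dual_norm :: "('k::real_normed_field, 'a) nspace \<Rightarrow> ('a \<Rightarrow> 'k) \<Rightarrow> real" where
  "dual_norm E f = (SUP x\<in>{x \<in> vecs E. nrm E x \<le> 1}. norm (f x))"

definition weakly_seq_complete ::
  "('k::real_normed_field, 'a::ab_group_add) nspace \<Rightarrow> bool" where
  "weakly_seq_complete E \<longleftrightarrow>
     (\<forall>s :: nat \<Rightarrow> 'a. range s \<subseteq> vecs E \<longrightarrow>
        (\<forall>f\<in>dual E. convergent (\<lambda>n. f (s n))) \<longrightarrow>
        (\<exists>x\<in>vecs E. \<forall>f\<in>dual E. (\<lambda>n. f (s n)) \<longlonglongrightarrow> f x))"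

(* For finite I the partial sums are eventually constant, so that this is the finite sum. *)
definition series_sums ::
  "('k, 'a::ab_group_add) nspace \<Rightarrow> nat set \<Rightarrow> (nat \<Rightarrow> 'a) \<Rightarrow> 'a \<Rightarrow> bool" where
  "series_sums E I t x \<longleftrightarrow>
     limitin (ntopology E) (\<lambda>m. \<Sum>n\<in>I \<inter> {..m}. t n) x sequentially"

definition schauder_frame ::
  "('k::real_normed_field, 'a::ab_group_add) nspace \<Rightarrow> nat set \<Rightarrow> (nat \<Rightarrow> 'a) \<Rightarrow>
     (nat \<Rightarrow> 'a \<Rightarrow> 'k) \<Rightarrow> bool" where
  "schauder_frame E I x y \<longleftrightarrow>
     (I = {1..} \<or> (\<exists>r\<ge>1. I = {1..r})) \<and>
     (\<forall>n\<in>I. x n \<in> vecs E \<and> y n \<in> dual E) \<and>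
     (\<forall>v\<in>vecs E. series_sums E I (\<lambda>n. smul E (y n v) (x n)) v)"

definition besselian_schauder_frame ::
  "('k::real_normed_field, 'a::ab_group_add) nspace \<Rightarrow> nat set \<Rightarrow> (nat \<Rightarrow> 'a) \<Rightarrow>
     (nat \<Rightarrow> 'a \<Rightarrow> 'k) \<Rightarrow> bool" where
  "besselian_schauder_frame E I x y \<longleftrightarrow>
     schauder_frame E I x y \<and>
     (\<exists>A>0. \<forall>v\<in>vecs E. \<forall>f\<in>dual E.
        (\<lambda>n. norm (y n v) * norm (f (x n))) summable_on I \<and>
        (\<Sum>\<^sub>\<infinity>n\<in>I. norm (y n v) * norm (f (x n))) \<le> A * nrm E v * dual_norm E f)"

(* A finite I yields the algebraic bases of finite-dimensional spaces; r = 0 is the empty basis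
   of the zero space.  Coefficient sequences are taken extensional so as to be unique off I. *)
definition schauder_basis ::
  "('k::real_normed_field, 'a::ab_group_add) nspace \<Rightarrow> nat set \<Rightarrow> (nat \<Rightarrow> 'a) \<Rightarrow> bool" where
  "schauder_basis W I e \<longleftrightarrow>
     (I = {1..} \<or> (\<exists>r. I = {1..r})) \<and>
     (\<forall>n\<in>I. e n \<in> vecs W) \<and>
     (\<forall>w\<in>vecs W. \<exists>!a. a \<in> extensional I \<and> series_sums W I (\<lambda>n. smul W (a n) (e n)) w)"

definition unconditionally_convergent ::
  "('k, 'a::ab_group_add) nspace \<Rightarrow> nat set \<Rightarrow> (nat \<Rightarrow> 'a) \<Rightarrow> bool" where
  "unconditionally_convergent E I t \<longleftrightarrow>
     (\<forall>\<pi>. bij_betw \<pi> I I \<longrightarrow> (\<exists>z. series_sums E I (\<lambda>n. t (\<pi> n)) z))"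

definition unconditional_schauder_basis ::
  "('k::real_normed_field, 'a::ab_group_add) nspace \<Rightarrow> nat set \<Rightarrow> (nat \<Rightarrow> 'a) \<Rightarrow> bool" where
  "unconditional_schauder_basis W I e \<longleftrightarrow>
     schauder_basis W I e \<and>
     (\<forall>w\<in>vecs W. \<forall>a. series_sums W I (\<lambda>n. smul W (a n) (e n)) w \<longrightarrow>
        unconditionally_convergent W I (\<lambda>n. smul W (a n) (e n)))"

definition complemented_subspace ::
  "('k, 'a::ab_group_add) nspace \<Rightarrow> 'a set \<Rightarrow> bool" where
  "complemented_subspace W S \<longleftrightarrow>
     (\<exists>P. bounded_operator W W P \<and> (\<forall>x\<in>vecs W. P (P x) = P x) \<and> P ` vecs W = S)"

definition isometrically_isomorphic ::
  "('k, 'a::ab_group_add) nspace \<Rightarrow> ('k, 'b::ab_group_add) nspace \<Rightarrow> bool" where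
  "isometrically_isomorphic E F \<longleftrightarrow>
     (\<exists>T. bounded_operator E F T \<and> bij_betw T (vecs E) (vecs F) \<and>
        (\<forall>x\<in>vecs E. nrm F (T x) = nrm E x))"

lemma normed_space_diff:
  fixes E :: "('k::real_normed_field, 'a::ab_group_add) nspace"
  assumes "normed_space E" "x \<in> vecs E" "y \<in> vecs E"
  shows "x - y \<in> vecs E" "nrm E (y - x) = nrm E (x - y)"
proof -
  have vs: "vector_space (smul E)" and sub: "module.subspace (smul E) (vecs E)"
    using assms(1) by (simp_all add: normed_space_def)
  interpret vector_space "smul E" by (fact vs)
  show *: "x - y \<in> vecs E" using subspace_diff[OF sub assms(2,3)] .
  have "nrm E (smul E (-1) (x - y)) = norm (-1 :: 'k) * nrm E (x - y)"
    using assms(1) * unfolding normed_space_def by blast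
  then show "nrm E (y - x) = nrm E (x - y)"
    by simp
qed

lemma Metric_space_ndist:
  assumes E: "normed_space E"
  shows "Metric_space (vecs E) (ndist E)"
proof -
  note d = normed_space_diff[OF E]
  note e = E[unfolded normed_space_def, THEN conjunct2, THEN conjunct2]
  note nn = bspec[OF e[THEN conjunct1]]
  note z = bspec[OF e[THEN conjunct2, THEN conjunct1]]
  note tr = bspec[OF bspec[OF e[THEN conjunct2, THEN conjunct2, THEN conjunct2]]]
  show ?thesis
  proof (rule Metric_space.intro)
    fix x y z
    show "0 \<le> ndist E x y" using nn[OF d(1)] by (simp add: ndist_def)
    show "ndist E x y = ndist E y x"
      using d(2)[of x y] by (auto simp: ndist_def)
    show "ndist E x y = 0 \<longleftrightarrow> x = y" if "x \<in> vecs E" "y \<in> vecs E"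
      using z[OF d(1)[OF that]] that by (simp add: ndist_def)
    show "ndist E x z \<le> ndist E x y + ndist E y z"
      if "x \<in> vecs E" "y \<in> vecs E" "z \<in> vecs E"
      using tr[OF d(1)[OF that(1,2)] d(1)[OF that(2,3)]] that by (simp add: ndist_def)
  qed
qed

lemma banach_space_real:
  "banach_space \<lparr>vecs = UNIV :: 'a::banach set, smul = scaleR, nrm = norm\<rparr>" (is "banach_space ?E")
proof -
  have d: "ndist ?E = dist" by (intro ext) (simp add: ndist_def dist_norm)
  have "normed_space ?E"
    unfolding normed_space_def
    by (simp add: norm_triangle_ineq real_vector.vector_space_axioms
        module.subspace_UNIV[OF real_vector.module_axioms])
  moreover have "Metric_space.mcomplete (UNIV :: 'a set) dist"
    by (rule iffD2[OF mcomplete_iff_complete complete_UNIV])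
  ultimately show ?thesis by (simp add: banach_space_def d)
qed

end

theory Submission
  imports Defs
begin

text \<open>
  Let \<open>(\<xi> n, \<eta> n)\<close> be the frame, and let \<open>W\<close> be the space of all scalar sequences \<open>a\<close> for which the series
  of the vectors \<open>a n \<cdot> \<xi> n\<close> converges unconditionally, normed by the supremum of the norms of its finite partial
  sums. If no \<open>\<xi> n\<close> is zero, then \<open>W\<close> is a Banach space, and the unit sequences are an
  unconditional basis of it, simply because tails of an unconditionally convergent series are uniformly small
  (\<open>unconditional_schauder_basis_unit_sequences\<close>). Summation is a bounded operator \<open>Q\<close> from \<open>W\<close> to \<open>E\<close>.

  The point of the proof is that the analysis map \<open>J v = (\<lambda>n. \<eta> n v)\<close> takes its values in \<open>W\<close>, that is,
  that frame expansions converge unconditionally. The Bessel condition says that the expansion of \<open>v\<close>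
  becomes absolutely summable under every functional. Weak sequential completeness then supplies a weak sum
  of each subseries, and an argument of Orlicz-Pettis type turns this into norm convergence
  (\<open>weakly_unconditionally_Cauchy_imp_unconditionally_Cauchy\<close>). Weak sums depend
  on the subseries through a pointwise limit of continuous maps, because of the frame expansions, so that
  Baire's theorem in the Cantor space applies.

  Now \<open>J\<close> is bounded by the uniform boundedness principle, and \<open>Q \<circ> J\<close> is the identity of \<open>E\<close>, so that
  \<open>J \<circ> Q\<close> is a bounded projection of \<open>W\<close> onto an isomorphic copy of \<open>E\<close>. An equivalent norm on \<open>W\<close>
  makes \<open>J\<close> isometric (\<open>isometric_renorming\<close>) and preserves completeness and the basis.

  The argument is the same for real and complex scalars, hence carried out over any complete normed field
  \<open>'k\<close> that contains the reals.
\<close>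

section \<open>Normed and Banach spaces as records\<close>

locale normed_nspace =
  fixes E :: "('k::{real_normed_field,banach}, 'a::ab_group_add) nspace"
  assumes normed: "normed_space E"
begin

sublocale vs: vector_space "smul E"
  using normed by (simp add: normed_space_def)

sublocale ms: Metric_space "vecs E" "ndist E"
  by (rule Metric_space_ndist[OF normed])

lemma subspace_vecs: "vs.subspace (vecs E)"
  using normed by (simp add: normed_space_def)

lemma zero_vecs [simp]: "0 \<in> vecs E"
  using vs.subspace_0[OF subspace_vecs] .

lemma add_vecs [simp]: "x \<in> vecs E \<Longrightarrow> y \<in> vecs E \<Longrightarrow> x + y \<in> vecs E"
  using vs.subspace_add[OF subspace_vecs] .

lemma diff_vecs [simp]: "x \<in> vecs E \<Longrightarrow> y \<in> vecs E \<Longrightarrow> x - y \<in> vecs E"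
  using vs.subspace_diff[OF subspace_vecs] .

lemma smul_vecs [simp]: "x \<in> vecs E \<Longrightarrow> smul E c x \<in> vecs E"
  using vs.subspace_scale[OF subspace_vecs] .

lemma sum_vecs [simp]: "(\<And>i. i \<in> A \<Longrightarrow> f i \<in> vecs E) \<Longrightarrow> sum f A \<in> vecs E"
  using vs.subspace_sum[OF subspace_vecs] .

lemma nrm_nonneg [simp]: "x \<in> vecs E \<Longrightarrow> 0 \<le> nrm E x"
  using normed by (simp add: normed_space_def)

lemma nrm_eq_0 [simp]: "x \<in> vecs E \<Longrightarrow> nrm E x = 0 \<longleftrightarrow> x = 0"
  using normed by (simp add: normed_space_def)

lemma nrm_0 [simp]: "nrm E 0 = 0"
  by simp

lemma nrm_smul [simp]: "x \<in> vecs E \<Longrightarrow> nrm E (smul E c x) = norm c * nrm E x"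
  using normed by (simp add: normed_space_def)

lemma nrm_add: "x \<in> vecs E \<Longrightarrow> y \<in> vecs E \<Longrightarrow> nrm E (x + y) \<le> nrm E x + nrm E y"
  using normed by (simp add: normed_space_def)

lemma nrm_commute: "x \<in> vecs E \<Longrightarrow> y \<in> vecs E \<Longrightarrow> nrm E (x - y) = nrm E (y - x)"
  using normed_space_diff(2)[OF normed] by metis

lemma nrm_diff_triangle:
  assumes "x \<in> vecs E" "y \<in> vecs E" "z \<in> vecs E"
  shows "nrm E (x - z) \<le> nrm E (x - y) + nrm E (y - z)"
  using nrm_add[of "x - y" "y - z"] assms by simp

lemma nrm_diff: "x \<in> vecs E \<Longrightarrow> y \<in> vecs E \<Longrightarrow> nrm E (x - y) \<le> nrm E x + nrm E y"
  using nrm_diff_triangle[of x 0 y] nrm_commute[of 0 y] by simp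

lemma nrm_abs_diff:
  assumes "x \<in> vecs E" "y \<in> vecs E"
  shows "\<bar>nrm E x - nrm E y\<bar> \<le> nrm E (x - y)"
  using nrm_add[of "x - y" y] nrm_add[of "y - x" x] nrm_commute[of x y] assms by simp

lemma nrm_sum:
  assumes "\<And>i. i \<in> A \<Longrightarrow> f i \<in> vecs E"
  shows "nrm E (sum f A) \<le> (\<Sum>i\<in>A. nrm E (f i))"
  using assms
proof (induction A rule: infinite_finite_induct)
  case (insert i A)
  then show ?case
    using nrm_add[of "f i" "sum f A"] by fastforce
qed simp_all

lemma limitin_iff:
  assumes "\<And>n. s n \<in> vecs E"
  shows "limitin (ntopology E) s x sequentially \<longleftrightarrow>
    x \<in> vecs E \<and> (\<lambda>n. nrm E (s n - x)) \<longlonglongrightarrow> 0"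
  using assms
  by (auto simp: ms.limit_metric_sequentially ndist_def LIMSEQ_iff)

lemma limitin_unique:
  "limitin (ntopology E) s x sequentially \<Longrightarrow> limitin (ntopology E) s y sequentially \<Longrightarrow> x = y"
  using ms.limitin_metric_unique trivial_limit_sequentially by blast

lemma dual_add: "f \<in> dual E \<Longrightarrow> x \<in> vecs E \<Longrightarrow> y \<in> vecs E \<Longrightarrow> f (x + y) = f x + f y"
  by (simp add: dual_def bounded_operator_def)

lemma dual_smul: "f \<in> dual E \<Longrightarrow> x \<in> vecs E \<Longrightarrow> f (smul E c x) = c * f x"
  by (simp add: dual_def bounded_operator_def scalars_def)

lemma dual_zero: "f \<in> dual E \<Longrightarrow> f 0 = 0"
  using dual_add[of f 0 0] by simp

lemma dual_diff: "f \<in> dual E \<Longrightarrow> x \<in> vecs E \<Longrightarrow> y \<in> vecs E \<Longrightarrow> f (x - y) = f x - f y"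
  using dual_add[of f "x - y" y] by simp

lemma dual_sum:
  assumes "f \<in> dual E" "\<And>i. i \<in> A \<Longrightarrow> g i \<in> vecs E"
  shows "f (sum g A) = (\<Sum>i\<in>A. f (g i))"
  using assms(2)
  by (induction A rule: infinite_finite_induct) (auto simp: assms(1) dual_zero dual_add)

lemma dual_bound: "f \<in> dual E \<Longrightarrow> \<exists>B. \<forall>x\<in>vecs E. norm (f x) \<le> B * nrm E x"
  by (simp add: dual_def bounded_operator_def scalars_def)

text \<open>The norm of a combination of fixed vectors depends continuously on the coefficients.\<close>

lemma tendsto_nrm_combination:
  assumes \<xi>: "\<And>n. n \<in> A \<Longrightarrow> \<xi> n \<in> vecs E"
    and c: "\<And>n. n \<in> A \<Longrightarrow> ((\<lambda>s. c s n) \<longlongrightarrow> l n) F"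
  shows "((\<lambda>s. nrm E (\<Sum>n\<in>A. smul E (c s n) (\<xi> n))) \<longlongrightarrow> nrm E (\<Sum>n\<in>A. smul E (l n) (\<xi> n))) F"
proof -
  let ?u = "\<lambda>c. \<Sum>n\<in>A. smul E (c n) (\<xi> n)"
  have "((\<lambda>s. \<Sum>n\<in>A. norm (c s n - l n) * nrm E (\<xi> n)) \<longlongrightarrow> (\<Sum>n\<in>A. norm (l n - l n) * nrm E (\<xi> n))) F"
    using c by (intro tendsto_intros) auto
  moreover have "norm (nrm E (?u (c s)) - nrm E (?u l)) \<le> (\<Sum>n\<in>A. norm (c s n - l n) * nrm E (\<xi> n))" for s
  proof -
    have "?u (c s) - ?u l = (\<Sum>n\<in>A. smul E (c s n - l n) (\<xi> n))"
      by (simp add: sum_subtractf vs.scale_left_diff_distrib)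
    then show ?thesis
      using nrm_abs_diff[of "?u (c s)" "?u l"] nrm_sum[of A "\<lambda>n. smul E (c s n - l n) (\<xi> n)"] \<xi>
      by simp
  qed
  ultimately show ?thesis
    by (subst LIM_zero_iff[symmetric]) (rule Lim_null_comparison, auto)
qed

end

lemma bounded_operator_zero:
  assumes "normed_nspace E" "bounded_operator E F T"
  shows "T 0 = 0"
proof -
  interpret E: normed_nspace E by fact
  have "T (0 + 0) = T 0 + T 0"
    using assms(2) E.zero_vecs unfolding bounded_operator_def by blast
  then show ?thesis by simp
qed

lemma bounded_operator_diff:
  assumes "normed_nspace E" "bounded_operator E F T" "x \<in> vecs E" "y \<in> vecs E"
  shows "T (x - y) = T x - T y"
proof -
  interpret E: normed_nspace E by fact
  have "T (x - y + y) = T (x - y) + T y"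
    using assms(2-) E.diff_vecs unfolding bounded_operator_def by blast
  then show ?thesis by (simp add: algebra_simps)
qed

lemma bounded_operator_bound:
  assumes "normed_nspace E" "bounded_operator E F T"
  obtains B where "B \<ge> 0" "\<And>x. x \<in> vecs E \<Longrightarrow> nrm F (T x) \<le> B * nrm E x"
proof -
  interpret E: normed_nspace E by fact
  obtain B where B: "\<And>x. x \<in> vecs E \<Longrightarrow> nrm F (T x) \<le> B * nrm E x"
    using assms unfolding bounded_operator_def by blast
  have "nrm F (T x) \<le> \<bar>B\<bar> * nrm E x" if "x \<in> vecs E" for x
    using B[OF that] mult_right_mono[OF abs_ge_self[of B] E.nrm_nonneg[OF that]] by linarith
  then show thesis
    using that[of "\<bar>B\<bar>"] by simp
qed

locale banach_nspace = normed_nspace +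
  assumes mcomplete: "ms.mcomplete"
begin

lemma Cauchy_limit:
  assumes "\<And>n. s n \<in> vecs E"
    and "\<And>e. e > 0 \<Longrightarrow> \<exists>N. \<forall>m\<ge>N. \<forall>n\<ge>N. nrm E (s m - s n) < e"
  obtains x where "limitin (ntopology E) s x sequentially"
proof -
  have "ms.MCauchy s"
    unfolding ms.MCauchy_def using assms by (auto simp: ndist_def)
  then show thesis
    using mcomplete that unfolding ms.mcomplete_def by blast
qed

end

lemma (in normed_nspace) banach_nspaceI:
  assumes "\<And>s. (\<And>n. s n \<in> vecs E) \<Longrightarrow>
      (\<And>e. e > 0 \<Longrightarrow> \<exists>N. \<forall>m\<ge>N. \<forall>n\<ge>N. nrm E (s m - s n) < e) \<Longrightarrow>
      \<exists>x\<in>vecs E. (\<lambda>n. nrm E (s n - x)) \<longlonglongrightarrow> 0"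
  shows "banach_nspace E"
proof
  show "ms.mcomplete"
    unfolding ms.mcomplete_def
  proof (intro allI impI)
    fix s assume "ms.MCauchy s"
    then have s: "s n \<in> vecs E" for n
      unfolding ms.MCauchy_def by blast
    have c: "\<exists>N. \<forall>m\<ge>N. \<forall>n\<ge>N. nrm E (s m - s n) < e" if "e > 0" for e
      using \<open>ms.MCauchy s\<close> s that unfolding ms.MCauchy_def ndist_def by simp
    obtain x where "x \<in> vecs E" "(\<lambda>n. nrm E (s n - x)) \<longlonglongrightarrow> 0"
      using assms[OF s c] by blast
    then show "\<exists>x. limitin (ntopology E) s x sequentially"
      using limitin_iff[of s] s by blast
  qed
qed

lemma banach_space_iff: "banach_space E \<longleftrightarrow> banach_nspace E"
  by (auto simp: banach_space_def banach_nspace_def banach_nspace_axioms_def normed_nspace_def)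

section \<open>The uniform boundedness principle\<close>

text \<open>
  The sets of vectors on which all operators of the family stay below a given integer are closed and
  cover the space, so by Baire one of them contains a ball around some point \<open>z\<close>; subtracting the value at
  \<open>z\<close> moves the bound to a ball around the origin.
\<close>
lemma uniform_boundedness:
  fixes E :: "('k::{real_normed_field,banach}, 'a::ab_group_add) nspace"
    and F :: "('k, 'b::ab_group_add) nspace"
  assumes "banach_nspace E" "normed_nspace F"
    and T: "\<And>T. T \<in> \<T> \<Longrightarrow> bounded_operator E F T"
    and bdd: "\<And>x. x \<in> vecs E \<Longrightarrow> \<exists>B. \<forall>T\<in>\<T>. nrm F (T x) \<le> B"
  shows "\<exists>C. \<forall>T\<in>\<T>. \<forall>x\<in>vecs E. nrm F (T x) \<le> C * nrm E x"
proof -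
  interpret E: banach_nspace E by fact
  interpret F: normed_nspace F by fact
  have TF: "T x \<in> vecs F" if "T \<in> \<T>" "x \<in> vecs E" for T x
    using T[OF that(1)] that(2) by (auto simp: bounded_operator_def)
  define A where "A k = {x \<in> vecs E. \<forall>T\<in>\<T>. nrm F (T x) \<le> real k}" for k :: nat
  have closed: "closedin (ntopology E) (A k)" for k
    unfolding E.ms.metric_closedin_iff_sequentially_closed
  proof (intro conjI allI impI)
    show "A k \<subseteq> vecs E" by (auto simp: A_def)
    fix s x assume *: "range s \<subseteq> A k \<and> limitin (ntopology E) s x sequentially"
    then have s: "s n \<in> vecs E" and sA: "s n \<in> A k" for n
      by (auto simp: A_def)
    with * have x: "x \<in> vecs E" and lim: "(\<lambda>n. nrm E (s n - x)) \<longlonglongrightarrow> 0"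
      using E.limitin_iff[of s] by auto
    have "nrm F (T x) \<le> real k" if T_in: "T \<in> \<T>" for T
    proof -
      obtain B where B: "\<And>x. x \<in> vecs E \<Longrightarrow> nrm F (T x) \<le> B * nrm E x"
        using bounded_operator_bound[OF E.normed_nspace_axioms T[OF T_in]] by blast
      have "nrm F (T x) \<le> real k + B * nrm E (s n - x)" for n
      proof -
        have "nrm F (T x) \<le> nrm F (T (s n)) + nrm F (T (s n) - T x)"
          using F.nrm_diff[of "T (s n)" "T (s n) - T x"] TF[OF T_in] s x by simp
        also have "T (s n) - T x = T (s n - x)"
          using bounded_operator_diff[OF E.normed_nspace_axioms T[OF T_in] s x] by simp
        also have "nrm F (T (s n)) + nrm F (T (s n - x)) \<le> real k + B * nrm E (s n - x)"
          using sA[of n] T_in B[of "s n - x"] s x by (intro add_mono) (auto simp: A_def)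
        finally show ?thesis .
      qed
      moreover have "(\<lambda>n. real k + B * nrm E (s n - x)) \<longlonglongrightarrow> real k + B * 0"
        by (intro tendsto_intros lim)
      ultimately show ?thesis
        using LIMSEQ_le_const by fastforce
    qed
    with x show "x \<in> A k" by (simp add: A_def)
  qed
  have cover: "\<Union>(range A) = vecs E"
  proof safe
    fix x assume x: "x \<in> vecs E"
    then obtain B where B: "\<forall>T\<in>\<T>. nrm F (T x) \<le> B"
      using bdd by blast
    obtain k where "B \<le> real k" using real_arch_simple by blast
    with B x have "x \<in> A k" by (force simp: A_def)
    then show "x \<in> \<Union>(range A)" by blast
  qed (auto simp: A_def)
  have "\<exists>k. ntopology E interior_of A k \<noteq> {}"
  proof (rule ccontr)
    assume "\<not> ?thesis"
    then have "ntopology E interior_of \<Union>(range A) = {}"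
      using closed by (intro E.ms.metric_Baire_category_alt E.mcomplete) auto
    then show False
      using cover interior_of_topspace[of "ntopology E"] E.zero_vecs by auto
  qed
  then obtain k z where "z \<in> ntopology E interior_of A k" by blast
  then obtain U where U: "openin (ntopology E) U" "z \<in> U" "U \<subseteq> A k"
    by (auto simp: interior_of_def)
  then obtain r where r: "r > 0" "E.ms.mcball z r \<subseteq> A k"
    unfolding E.ms.openin_mtopology_mcball by (meson order_trans)
  have z: "z \<in> vecs E"
    using U by (auto simp: A_def)
  \<comment> \<open>Both \<open>z + u\<close> and \<open>z\<close> lie in the ball, which costs the factor 2.\<close>
  have ball: "nrm F (T u) \<le> 2 * k" if u: "u \<in> vecs E" "nrm E u \<le> r" "T \<in> \<T>" for u T
  proof -
    have "z + u \<in> E.ms.mcball z r" "z \<in> E.ms.mcball z r"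
      using z u r(1) E.nrm_commute[of z "z + u"] by (auto simp: ndist_def)
    with r(2) have "z + u \<in> A k" "z \<in> A k" by blast+
    then have "nrm F (T (z + u) - T z) \<le> real k + real k"
      using u(3) TF[OF u(3)] z u(1) F.nrm_diff[of "T (z + u)" "T z"] by (force simp: A_def)
    then show ?thesis
      using bounded_operator_diff[OF E.normed_nspace_axioms T[OF u(3)], of "z + u" z] z u(1) by simp
  qed
  have "nrm F (T x) \<le> (2 * k / r) * nrm E x" if "T \<in> \<T>" and x: "x \<in> vecs E" for T x
  proof (cases "x = 0")
    case True
    then show ?thesis
      using bounded_operator_zero[OF E.normed_nspace_axioms T[OF that(1)]] by simp
  next
    case False
    then have n: "nrm E x > 0"
      using E.nrm_nonneg[OF x] E.nrm_eq_0[OF x] by linarith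
    define c :: 'k where "c = of_real (r / nrm E x)"
    have norm_c: "norm c = r / nrm E x" using n r(1) by (simp add: c_def norm_divide)
    have "nrm F (T (smul E c x)) \<le> 2 * k"
      using x n norm_c r(1) by (intro ball that(1)) simp_all
    moreover have "T (smul E c x) = smul F c (T x)"
      using T[OF that(1)] x by (auto simp: bounded_operator_def)
    ultimately have "r / nrm E x * nrm F (T x) \<le> 2 * k"
      using TF[OF that(1) x] norm_c by simp
    then show ?thesis
      using n r(1) by (simp add: field_simps)
  qed
  then show ?thesis by blast
qed

section \<open>Weakly unconditionally Cauchy series in spaces with a frame\<close>

text \<open>
  The Cauchy condition for the net of all finite partial sums. In a Banach space it is equivalent to
  unconditional convergence, and it is the form in which convergence can be checked without naming the sum.
\<close>

definition unconditionally_Cauchy :: "('k, 'a::ab_group_add) nspace \<Rightarrow> (nat \<Rightarrow> 'a) \<Rightarrow> bool" where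
  "unconditionally_Cauchy E t \<longleftrightarrow>
     (\<forall>e>0. \<exists>N. \<forall>A. finite A \<and> A \<subseteq> {N..} \<longrightarrow> nrm E (sum t A) \<le> e)"

lemma summable_norm_small_tails:
  fixes g :: "nat \<Rightarrow> real"
  assumes "summable g" "\<And>n. g n \<ge> 0" "e > 0"
  obtains N where "\<And>A. finite A \<Longrightarrow> A \<subseteq> {N..} \<Longrightarrow> sum g A \<le> e"
proof -
  obtain N where N: "\<And>m n. m \<ge> N \<Longrightarrow> norm (sum g {m..<n}) < e"
    using assms(1,3) unfolding summable_Cauchy by blast
  have "sum g A \<le> e" if A: "finite A" "A \<subseteq> {N..}" for A
  proof -
    have "A \<subseteq> {N..<Suc (Max A)}"
      using A by (auto simp: less_Suc_eq_le)
    then have "sum g A \<le> sum g {N..<Suc (Max A)}"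
      by (intro sum_mono2) (auto simp: assms(2))
    also have "\<dots> \<le> e"
      using N[OF order_refl, of "Suc (Max A)"] by simp
    finally show ?thesis .
  qed
  then show thesis by (rule that)
qed

text \<open>
  Baire's theorem in the Cantor space: its nonempty open sets contain cylinders, that is, sets of all
  sequences with a prescribed initial segment.
\<close>

lemma Baire_Cantor:
  fixes A :: "nat \<Rightarrow> (nat \<Rightarrow> bool) set"
  assumes closed: "\<And>m. closed (A m)" and cover: "(\<Union>m. A m) = UNIV"
  shows "\<exists>m \<sigma> N. \<forall>\<tau>. (\<forall>i<N. \<tau> i = \<sigma> i) \<longrightarrow> \<tau> \<in> A m"
proof -
  have "compact_space (product_topology (\<lambda>_::nat. euclidean :: bool topology) UNIV)"
    by (simp add: compact_space_product_topology compact_space_def[of "euclidean :: bool topology"] finite_imp_compact)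
  moreover have "Hausdorff_space (euclidean :: bool topology)"
    unfolding Hausdorff_space_def
  proof (intro allI impI)
    fix x y :: bool assume "x \<in> topspace euclidean \<and> y \<in> topspace euclidean \<and> x \<noteq> y"
    then show "\<exists>U V. openin euclidean U \<and> openin euclidean V \<and> x \<in> U \<and> y \<in> V \<and> disjnt U V"
      by (intro exI[of _ "{x}"] exI[of _ "{y}"]) (simp add: open_discrete)
  qed
  then have "Hausdorff_space (product_topology (\<lambda>_::nat. euclidean :: bool topology) UNIV)"
    by (simp add: Hausdorff_space_product_topology)
  ultimately have "compact_space (euclidean :: (nat \<Rightarrow> bool) topology)"
      "Hausdorff_space (euclidean :: (nat \<Rightarrow> bool) topology)"
    by (simp_all add: euclidean_product_topology)
  then have *: "locally_compact_space (euclidean :: (nat \<Rightarrow> bool) topology)"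
      "regular_space (euclidean :: (nat \<Rightarrow> bool) topology)"
    by (simp_all add: compact_imp_locally_compact_space compact_Hausdorff_imp_regular_space)
  have "\<exists>m. euclidean interior_of A m \<noteq> {}"
  proof (rule ccontr)
    assume "\<not> ?thesis"
    then have "euclidean interior_of \<Union>(range A) = {}"
      using closed by (intro Baire_category_aux[OF *]) auto
    then show False
      using cover interior_of_topspace[of "euclidean :: (nat \<Rightarrow> bool) topology"] by simp
  qed
  then obtain m \<sigma> U where U: "open U" "\<sigma> \<in> U" "U \<subseteq> A m"
    by (auto simp: interior_of_def)
  obtain X where X: "\<sigma> \<in> Pi\<^sub>E UNIV X" "finite {i. X i \<noteq> UNIV}" "Pi\<^sub>E UNIV X \<subseteq> U"
    using product_topology_open_contains_basis[OF U(1)[unfolded open_fun_def] U(2)] by auto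
  obtain N where N: "\<And>i. X i \<noteq> UNIV \<Longrightarrow> i < N"
    using X(2) unfolding finite_nat_set_iff_bounded by auto
  have "\<tau> \<in> A m" if "\<forall>i<N. \<tau> i = \<sigma> i" for \<tau>
  proof -
    have "\<tau> i \<in> X i" for i
      using X(1) N[of i] that by (cases "X i = UNIV") (auto simp: PiE_iff)
    then show ?thesis
      using X(3) U(3) by (auto simp: PiE_iff)
  qed
  then show ?thesis by blast
qed

context normed_nspace
begin

text \<open>
  The partial sums of any subseries form a weakly Cauchy sequence, since every functional turns the
  series into an absolutely convergent one. This is where weak sequential completeness enters.
\<close>

lemma subseries_weakly_convergent:
  fixes t :: "nat \<Rightarrow> 'a"
  assumes wsc: "weakly_seq_complete E"
    and t: "\<And>l. t l \<in> vecs E"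
    and wuc: "\<And>f. f \<in> dual E \<Longrightarrow> summable (\<lambda>l. norm (f (t l)))"
  shows "\<exists>z\<in>vecs E. \<forall>f\<in>dual E. f z = (\<Sum>l. if \<sigma> l then f (t l) else 0)"
proof -
  define s where "s m = (\<Sum>l<m. if \<sigma> l then t l else 0)" for m
  have s: "s m \<in> vecs E" for m
    unfolding s_def by (intro sum_vecs) (simp add: t)
  have fs: "(\<lambda>m. f (s m)) \<longlonglongrightarrow> (\<Sum>l. if \<sigma> l then f (t l) else 0)" if f: "f \<in> dual E" for f
  proof -
    have "summable (\<lambda>l. if \<sigma> l then f (t l) else 0)"
      by (rule summable_comparison_test[OF _ wuc[OF f]]) auto
    moreover have "f (s m) = (\<Sum>l<m. if \<sigma> l then f (t l) else 0)" for m
      unfolding s_def using f t by (subst dual_sum[OF f]) (auto intro!: sum.cong simp: dual_zero)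
    ultimately show ?thesis
      using summable_LIMSEQ by simp
  qed
  have "\<forall>f\<in>dual E. convergent (\<lambda>n. f (s n))"
    using fs by (blast intro: convergentI)
  then obtain z where "z \<in> vecs E" "\<forall>f\<in>dual E. (\<lambda>n. f (s n)) \<longlonglongrightarrow> f z"
    using wsc s unfolding weakly_seq_complete_def by blast
  then show ?thesis
    using fs by (meson LIMSEQ_unique)
qed

text \<open>
  Encode a subseries by \<open>\<sigma> :: nat \<Rightarrow> bool\<close> and let \<open>T \<sigma>\<close> be its weak sum. Each frame coordinate
  \<open>\<eta> n (T \<sigma>)\<close> is a uniform limit of continuous functions of \<open>\<sigma>\<close>, so every frame expansion \<open>S m (T \<sigma>)\<close>,
  having finitely many terms, is norm continuous in \<open>\<sigma>\<close>. Since \<open>S m (T \<sigma>)\<close> tends to \<open>T \<sigma>\<close> in norm, the map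
  \<open>T\<close> is a pointwise limit of continuous maps on the Cantor space, and Baire's theorem yields a cylinder and
  an \<open>m\<close> for which \<open>S m\<close> approximates \<open>T\<close> uniformly on that cylinder. A block of terms far out is the
  difference of two values of \<open>T\<close> on the cylinder, and \<open>S m\<close> maps it to a small vector because the
  coordinates of the series are absolutely summable; so the block itself is small.
\<close>

theorem weakly_unconditionally_Cauchy_imp_unconditionally_Cauchy:
  fixes t :: "nat \<Rightarrow> 'a"
  assumes wsc: "weakly_seq_complete E"
    and \<xi>: "\<And>n. \<xi> n \<in> vecs E" and \<eta>: "\<And>n. \<eta> n \<in> dual E"
    and frame: "\<And>v. v \<in> vecs E \<Longrightarrow> (\<lambda>m. nrm E ((\<Sum>n<m. smul E (\<eta> n v) (\<xi> n)) - v)) \<longlonglongrightarrow> 0"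
    and t: "\<And>l. t l \<in> vecs E"
    and wuc: "\<And>f. f \<in> dual E \<Longrightarrow> summable (\<lambda>l. norm (f (t l)))"
  shows "unconditionally_Cauchy E t"
  unfolding unconditionally_Cauchy_def
proof (intro allI impI)
  fix e :: real assume "e > 0"
  define S where "S m v = (\<Sum>n<m. smul E (\<eta> n v) (\<xi> n))" for m v
  have S: "S m v \<in> vecs E" for m v
    unfolding S_def by (simp add: \<xi>)
  have S_diff: "S m (v - w) = S m v - S m w" if "v \<in> vecs E" "w \<in> vecs E" for m v w
    using that by (simp add: S_def dual_diff \<eta> sum_subtractf vs.scale_left_diff_distrib)
  have "\<exists>T. \<forall>\<sigma>. T \<sigma> \<in> vecs E \<and> (\<forall>f\<in>dual E. f (T \<sigma>) = (\<Sum>l. if \<sigma> l then f (t l) else 0))"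
    using subseries_weakly_convergent[of t, OF wsc t wuc] by (intro choice) blast
  then obtain T where T: "\<And>\<sigma>. T \<sigma> \<in> vecs E"
    and fT: "\<And>\<sigma> f. f \<in> dual E \<Longrightarrow> f (T \<sigma>) = (\<Sum>l. if \<sigma> l then f (t l) else 0)"
    by blast
  have cont: "continuous_on UNIV (\<lambda>\<sigma>. \<eta> n (T \<sigma>))" for n
  proof -
    have "uniform_limit UNIV (\<lambda>m \<sigma>. \<Sum>l<m. if \<sigma> l then \<eta> n (t l) else 0)
        (\<lambda>\<sigma>. \<Sum>l. if \<sigma> l then \<eta> n (t l) else 0) sequentially"
      by (rule Weierstrass_m_test[OF _ wuc[OF \<eta>]]) auto
    moreover have "continuous_on UNIV (\<lambda>\<sigma>::nat \<Rightarrow> bool. if \<sigma> l then \<eta> n (t l) else 0)" for l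
      by (rule continuous_on_compose2[of UNIV "\<lambda>b. if b then \<eta> n (t l) else 0" UNIV "\<lambda>\<sigma>. \<sigma> l"])
        (simp_all add: continuous_on_discrete)
    ultimately show ?thesis
      unfolding fT[OF \<eta>]
      by (intro uniform_limit_theorem[OF _ _ trivial_limit_sequentially])
        (simp_all add: continuous_on_sum)
  qed
  define A where "A m = {\<sigma>. \<forall>i\<ge>m. nrm E (S i (T \<sigma>) - S m (T \<sigma>)) \<le> e/4}" for m
  have S_mono: "S i v - S m v = (\<Sum>n\<in>{m..<i}. smul E (\<eta> n v) (\<xi> n))" if "i \<ge> m" for i m v
    unfolding S_def using that
    by (simp add: lessThan_atLeast0 sum_diff_nat_ivl)
  have closed: "closed (A m)" for m
  proof -
    have "closed {\<sigma>. nrm E (S i (T \<sigma>) - S m (T \<sigma>)) \<le> e/4}" if "i \<ge> m" for i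
      unfolding S_mono[OF that]
      using cont unfolding continuous_on_def
      by (intro closed_Collect_le continuous_on_const)
        (auto simp: continuous_on_def intro!: tendsto_nrm_combination \<xi>)
    moreover have "A m = (\<Inter>i\<in>{m..}. {\<sigma>. nrm E (S i (T \<sigma>) - S m (T \<sigma>)) \<le> e/4})"
      by (auto simp: A_def)
    ultimately show ?thesis
      by (simp add: closed_INT)
  qed
  have cover: "(\<Union>m. A m) = UNIV"
  proof -
    have "\<exists>m. \<sigma> \<in> A m" for \<sigma>
    proof -
      have "\<forall>\<^sub>F m in sequentially. nrm E (S m (T \<sigma>) - T \<sigma>) < e/8"
        using order_tendstoD(2)[OF frame[OF T], of "e/8"] \<open>e > 0\<close> by (simp add: S_def)
      then obtain m where m: "\<And>i. i \<ge> m \<Longrightarrow> nrm E (S i (T \<sigma>) - T \<sigma>) < e/8"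
        unfolding eventually_sequentially by blast
      have "nrm E (S i (T \<sigma>) - S m (T \<sigma>)) \<le> e/4" if "i \<ge> m" for i
        using nrm_diff_triangle[of "S i (T \<sigma>)" "T \<sigma>" "S m (T \<sigma>)"] m[OF that] m[OF order_refl]
          nrm_commute[of "T \<sigma>" "S m (T \<sigma>)"] S T by fastforce
      then show ?thesis by (auto simp: A_def)
    qed
    then show ?thesis by blast
  qed
  obtain m \<sigma> N where A: "\<And>\<tau>. \<forall>i<N. \<tau> i = \<sigma> i \<Longrightarrow> \<tau> \<in> A m"
    using Baire_Cantor[OF closed cover] by blast
  \<comment> \<open>\<open>g l\<close> bounds the norm of \<open>S m (t l)\<close>.\<close>
  define g where "g l = (\<Sum>n<m. norm (\<eta> n (t l)) * nrm E (\<xi> n))" for l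
  have g: "summable g" "\<And>l. g l \<ge> 0"
    unfolding g_def by (auto intro!: summable_sum summable_mult2 wuc \<eta> sum_nonneg simp: \<xi>)
  obtain N' where N': "\<And>B. finite B \<Longrightarrow> B \<subseteq> {N'..} \<Longrightarrow> sum g B \<le> e/4"
    using summable_norm_small_tails[OF g, of "e/4"] \<open>e > 0\<close> by auto
  show "\<exists>N. \<forall>B. finite B \<and> B \<subseteq> {N..} \<longrightarrow> nrm E (sum t B) \<le> e"
  proof (intro exI allI impI)
    fix B assume B: "finite B \<and> B \<subseteq> {max N N'..}"
    define u where "u = sum t B"
    have u: "u \<in> vecs E" by (simp add: u_def t)
    \<comment> \<open>Two points of the cylinder that differ exactly on \<open>B\<close>: the weak sums differ by \<open>u\<close>.\<close>
    define \<tau> \<tau>' where "\<tau> l \<longleftrightarrow> l < N \<and> \<sigma> l" and "\<tau>' l \<longleftrightarrow> \<tau> l \<or> l \<in> B" for l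
    have \<tau>A: "\<tau> \<in> A m" "\<tau>' \<in> A m"
      using B by (auto intro!: A simp: \<tau>_def \<tau>'_def)
    have "\<eta> n u = \<eta> n (T \<tau>' - T \<tau>)" for n
    proof -
      have "\<eta> n (T \<tau>') = (\<Sum>l\<in>{l. l < N \<and> \<sigma> l} \<union> B. \<eta> n (t l))"
        unfolding fT[OF \<eta>] using B by (subst suminf_finite[of "{l. l < N \<and> \<sigma> l} \<union> B"]) (auto simp: \<tau>_def \<tau>'_def)
      moreover have "\<eta> n (T \<tau>) = (\<Sum>l\<in>{l. l < N \<and> \<sigma> l}. \<eta> n (t l))"
        unfolding fT[OF \<eta>] by (subst suminf_finite[of "{l. l < N \<and> \<sigma> l}"]) (auto simp: \<tau>_def)
      moreover have "{l. l < N \<and> \<sigma> l} \<inter> B = {}"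
        using B by auto
      ultimately show ?thesis
        using B by (simp add: dual_diff[OF \<eta> T T] u_def dual_sum[OF \<eta> t] sum.union_disjoint)
    qed
    then have Su: "S i u = S i (T \<tau>') - S i (T \<tau>)" for i
      using S_diff[OF T T, of i \<tau>' \<tau>] by (simp add: S_def)
    have "nrm E (S m u) \<le> (\<Sum>n<m. norm (\<eta> n u) * nrm E (\<xi> n))"
      unfolding S_def using nrm_sum[of "{..<m}" "\<lambda>n. smul E (\<eta> n u) (\<xi> n)"] \<xi> by simp
    also have "\<dots> \<le> (\<Sum>n<m. (\<Sum>l\<in>B. norm (\<eta> n (t l))) * nrm E (\<xi> n))"
      by (intro sum_mono mult_right_mono) (auto simp: u_def dual_sum[OF \<eta> t] \<xi> norm_sum)
    also have "\<dots> = sum g B"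
      unfolding g_def sum_distrib_right by (rule sum.swap)
    also have "\<dots> \<le> e/4"
      using B by (intro N') auto
    finally have Sm: "nrm E (S m u) \<le> e/4" .
    obtain i where i: "i \<ge> m" "nrm E (S i u - u) < e/4"
      using eventually_happens[OF eventually_conj[OF eventually_ge_at_top[of m]
            order_tendstoD(2)[OF frame[OF u], of "e/4"]]] \<open>e > 0\<close> by (auto simp: S_def)
    \<comment> \<open>Uniform approximation on the cylinder, used at both points.\<close>
    have "S i u - S m u = (S i (T \<tau>') - S m (T \<tau>')) - (S i (T \<tau>) - S m (T \<tau>))"
      by (simp add: Su)
    then have "nrm E (S i u - S m u) \<le> e/4 + e/4"
      using nrm_diff[of "S i (T \<tau>') - S m (T \<tau>')" "S i (T \<tau>) - S m (T \<tau>)"] \<tau>A i(1) S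
      by (force simp: A_def)
    moreover have "nrm E u \<le> nrm E (S i u - u) + (nrm E (S i u - S m u) + nrm E (S m u))"
      using nrm_diff_triangle[of u "S i u" 0] nrm_diff_triangle[of "S i u" "S m u" 0]
        nrm_commute[of u "S i u"] S u by simp
    ultimately show "nrm E (sum t B) \<le> e"
      using Sm i(2) by (simp add: u_def)
  qed
qed

end

section \<open>The space of coefficients of unconditionally convergent series\<close>

text \<open>
  The norm is a supremum over finite index sets, not over bounded multipliers of the coefficients: the two
  give equivalent norms, and subset sums are what the Cauchy condition speaks of.
\<close>

definition unconditional_coefficients ::
  "('k::real_normed_field, 'a::ab_group_add) nspace \<Rightarrow> (nat \<Rightarrow> 'a) \<Rightarrow> ('k, nat \<Rightarrow> 'k) nspace" where
  "unconditional_coefficients E \<xi> =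
     \<lparr>vecs = {a. unconditionally_Cauchy E (\<lambda>n. smul E (a n) (\<xi> n))},
      smul = (\<lambda>c a n. c * a n),
      nrm = (\<lambda>a. SUP A\<in>Collect finite. nrm E (\<Sum>n\<in>A. smul E (a n) (\<xi> n)))\<rparr>"

text \<open>
  Coefficient sequences are indexed from 0 but Schauder bases from 1, whence the shift.
\<close>

definition unit_sequence :: "nat \<Rightarrow> nat \<Rightarrow> 'k::zero_neq_one" where
  "unit_sequence n i = (if i = n - 1 then 1 else 0)"

lemma vector_space_pointwise: "vector_space (\<lambda>(c::'k::field) a (n::'i). c * a n)"
  by unfold_locales (auto simp: fun_eq_iff algebra_simps)

lemma sum_function_apply: "(\<Sum>n\<in>A. f n) i = (\<Sum>n\<in>A. f n i)"
  for f :: "'n \<Rightarrow> 'i \<Rightarrow> 'b::comm_monoid_add"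
  by (induction A rule: infinite_finite_induct) auto

text \<open>
  If some \<open>\<xi> n\<close> were zero, then the supremum would only be a seminorm; with all of them nonzero it also
  controls every coefficient (lemma \<open>coordinate_le\<close> below).
\<close>

locale nonzero_sequence = banach_nspace E
  for E :: "('k::{real_normed_field,banach}, 'a::ab_group_add) nspace" +
  fixes \<xi> :: "nat \<Rightarrow> 'a"
  assumes \<xi>_vecs [simp]: "\<xi> n \<in> vecs E" and \<xi>_nonzero: "\<xi> n \<noteq> 0"
begin

abbreviation "W \<equiv> unconditional_coefficients E \<xi>"

definition combination :: "(nat \<Rightarrow> 'k) \<Rightarrow> nat set \<Rightarrow> 'a" where
  "combination a A = (\<Sum>n\<in>A. smul E (a n) (\<xi> n))"

lemma combination_vecs [simp]: "combination a A \<in> vecs E"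
  by (simp add: combination_def)

lemma combination_add: "combination (a + b) A = combination a A + combination b A"
  by (simp add: combination_def sum.distrib vs.scale_left_distrib)

lemma combination_diff: "combination (a - b) A = combination a A - combination b A"
  by (simp add: combination_def sum_subtractf vs.scale_left_diff_distrib)

lemma combination_scale: "combination (\<lambda>n. c * a n) A = smul E c (combination a A)"
  by (simp add: combination_def vs.scale_sum_right)

lemma vecs_W: "a \<in> vecs W \<longleftrightarrow>
    (\<forall>e>0. \<exists>N. \<forall>A. finite A \<and> A \<subseteq> {N..} \<longrightarrow> nrm E (combination a A) \<le> e)"
  by (simp add: unconditional_coefficients_def unconditionally_Cauchy_def combination_def)

lemma smul_W: "smul W c a = (\<lambda>n. c * a n)"
  by (simp add: unconditional_coefficients_def)

lemma nrm_W: "nrm W a = (SUP A\<in>Collect finite. nrm E (combination a A))"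
  by (simp add: unconditional_coefficients_def combination_def)

lemma nrm_W_le: "(\<And>A. finite A \<Longrightarrow> nrm E (combination a A) \<le> B) \<Longrightarrow> nrm W a \<le> B"
  unfolding nrm_W by (rule cSUP_least) auto

text \<open>
  Only finitely many terms lie before the point from which all finite partial sums are at most 1.
\<close>

lemma combination_bounded:
  assumes "a \<in> vecs W"
  shows "bdd_above ((\<lambda>A. nrm E (combination a A)) ` Collect finite)"
proof -
  obtain N where N: "\<And>A. finite A \<Longrightarrow> A \<subseteq> {N..} \<Longrightarrow> nrm E (combination a A) \<le> 1"
    using assms unfolding vecs_W by (meson zero_less_one)
  let ?B = "\<Sum>n<N. nrm E (smul E (a n) (\<xi> n))"
  have "nrm E (combination a A) \<le> ?B + 1" if "finite A" for A
  proof -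
    have "combination a A = combination a (A \<inter> {..<N}) + combination a (A \<inter> {N..})"
      unfolding combination_def using that
      by (subst sum.union_disjoint[symmetric]) (auto intro: arg_cong[where f = "sum _"])
    then have "nrm E (combination a A) \<le>
        nrm E (combination a (A \<inter> {..<N})) + nrm E (combination a (A \<inter> {N..}))"
      using nrm_add by simp
    also have "nrm E (combination a (A \<inter> {..<N})) \<le> (\<Sum>n\<in>A \<inter> {..<N}. nrm E (smul E (a n) (\<xi> n)))"
      unfolding combination_def by (intro nrm_sum) simp
    also have "\<dots> \<le> ?B"
      by (intro sum_mono2) auto
    finally show ?thesis
      using N[of "A \<inter> {N..}"] that by simp
  qed
  then show ?thesis by (auto intro!: bdd_aboveI2)
qed

lemma combination_le: "a \<in> vecs W \<Longrightarrow> finite A \<Longrightarrow> nrm E (combination a A) \<le> nrm W a"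
  unfolding nrm_W by (rule cSUP_upper[OF _ combination_bounded]) auto

lemma coordinate_le: "a \<in> vecs W \<Longrightarrow> norm (a n) * nrm E (\<xi> n) \<le> nrm W a"
  using combination_le[of a "{n}"] by (simp add: combination_def)

lemma nrm_\<xi>_pos: "nrm E (\<xi> n) > 0"
  using nrm_nonneg[OF \<xi>_vecs, of n] nrm_eq_0[OF \<xi>_vecs, of n] \<xi>_nonzero[of n] by linarith

lemma vecs_W_add:
  assumes "a \<in> vecs W" "b \<in> vecs W"
  shows "a + b \<in> vecs W"
  unfolding vecs_W
proof (intro allI impI)
  fix e :: real assume "e > 0"
  then have e: "e/2 > 0" by simp
  obtain N where N: "\<And>A. finite A \<Longrightarrow> A \<subseteq> {N..} \<Longrightarrow> nrm E (combination a A) \<le> e/2"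
    using assms(1) e unfolding vecs_W by meson
  obtain M where M: "\<And>A. finite A \<Longrightarrow> A \<subseteq> {M..} \<Longrightarrow> nrm E (combination b A) \<le> e/2"
    using assms(2) e unfolding vecs_W by meson
  have "nrm E (combination (a + b) A) \<le> e" if "finite A" "A \<subseteq> {max N M..}" for A
  proof -
    have "A \<subseteq> {N..}" "A \<subseteq> {M..}" using that(2) by auto
    then show ?thesis
      using N[OF that(1)] M[OF that(1)] nrm_add[of "combination a A" "combination b A"]
      by (simp add: combination_add)
  qed
  then show "\<exists>N. \<forall>A. finite A \<and> A \<subseteq> {N..} \<longrightarrow> nrm E (combination (a + b) A) \<le> e" by blast
qed

lemma vecs_W_scale:
  assumes "a \<in> vecs W"
  shows "(\<lambda>n. c * a n) \<in> vecs W"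
  unfolding vecs_W
proof (intro allI impI)
  fix e :: real assume "e > 0"
  then have "e / (norm c + 1) > 0"
    by (simp add: add_nonneg_pos)
  then obtain N where N: "\<And>A. finite A \<Longrightarrow> A \<subseteq> {N..} \<Longrightarrow> nrm E (combination a A) \<le> e / (norm c + 1)"
    using assms unfolding vecs_W by meson
  have "nrm E (combination (\<lambda>n. c * a n) A) \<le> e" if "finite A" "A \<subseteq> {N..}" for A
  proof -
    have "norm c * nrm E (combination a A) \<le> (norm c + 1) * (e / (norm c + 1))"
      using N[OF that] by (intro mult_mono) auto
    also have "\<dots> = e"
      using add_nonneg_pos[OF norm_ge_zero[of c] zero_less_one] by simp
    finally show ?thesis by (simp add: combination_scale)
  qed
  then show "\<exists>N. \<forall>A. finite A \<and> A \<subseteq> {N..} \<longrightarrow> nrm E (combination (\<lambda>n. c * a n) A) \<le> e" by blast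
qed

lemma finite_support_vecs_W:
  assumes "finite {n. a n \<noteq> 0}"
  shows "a \<in> vecs W"
  unfolding vecs_W
proof (intro allI impI)
  fix e :: real assume "e > 0"
  obtain N where N: "\<And>n. a n \<noteq> 0 \<Longrightarrow> n < N"
    using assms unfolding finite_nat_set_iff_bounded by auto
  have "combination a A = 0" if "A \<subseteq> {N..}" for A
    unfolding combination_def using N that by (intro sum.neutral) fastforce
  then show "\<exists>N. \<forall>A. finite A \<and> A \<subseteq> {N..} \<longrightarrow> nrm E (combination a A) \<le> e"
    using \<open>e > 0\<close> by (metis less_imp_le nrm_0)
qed

lemma normed_W: "normed_space W"
  unfolding normed_space_def
proof (intro conjI ballI allI)
  show vs: "vector_space (smul W)"
    using vector_space_pointwise by (simp add: smul_W[abs_def])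
  interpret W: vector_space "smul W" by (fact vs)
  show "W.subspace (vecs W)"
    unfolding W.subspace_def using vecs_W_add vecs_W_scale finite_support_vecs_W[of 0]
    by (auto simp: smul_W)
  show nonneg: "0 \<le> nrm W a" if "a \<in> vecs W" for a
    using combination_le[OF that, of "{}"] by (simp add: combination_def)
  show "nrm W a = 0 \<longleftrightarrow> a = 0" if a: "a \<in> vecs W" for a
  proof
    assume "nrm W a = 0"
    then have "norm (a n) * nrm E (\<xi> n) \<le> 0" for n
      using coordinate_le[OF a] by metis
    then show "a = 0"
      using nrm_\<xi>_pos by (auto simp: fun_eq_iff mult_le_0_iff not_le[symmetric])
  next
    assume "a = 0"
    then have "nrm W a \<le> 0"
      by (intro nrm_W_le) (simp add: combination_def)
    then show "nrm W a = 0"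
      using nonneg[OF a] by simp
  qed
  show "nrm W (a + b) \<le> nrm W a + nrm W b" if "a \<in> vecs W" "b \<in> vecs W" for a b
  proof (rule nrm_W_le)
    fix A :: "nat set" assume "finite A"
    then show "nrm E (combination (a + b) A) \<le> nrm W a + nrm W b"
      using nrm_add[of "combination a A" "combination b A"] combination_le[of a A] combination_le[of b A] that
      by (simp add: combination_add)
  qed
  show "nrm W (smul W c a) = norm c * nrm W a" if a: "a \<in> vecs W" for c a
  proof -
    have le: "nrm W (smul W c a) \<le> norm c * nrm W a" if "a \<in> vecs W" for c a
      unfolding smul_W using combination_le[OF that]
      by (intro nrm_W_le) (simp add: combination_scale mult_left_mono)
    show ?thesis
    proof (cases "c = 0")
      case True
      then show ?thesis
        using le[OF a, of 0] nonneg[of "smul W 0 a"] vecs_W_scale[OF a, of 0] by (simp add: smul_W)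
    next
      case False
      have "nrm W (smul W (inverse c) (smul W c a)) \<le> norm (inverse c) * nrm W (smul W c a)"
        by (rule le) (simp add: smul_W vecs_W_scale a)
      moreover have "smul W (inverse c) (smul W c a) = a"
        using False by (simp add: smul_W mult.assoc[symmetric])
      ultimately show ?thesis
        using le[OF a, of c] False by (simp add: norm_inverse norm_divide field_simps)
    qed
  qed
qed

sublocale W: normed_nspace W
  by unfold_locales (rule normed_W)

text \<open>
  A Cauchy sequence converges coordinatewise, and for each finite index set the partial sums pass to the
  limit; the estimates are uniform in the index set, so they give both membership and norm convergence.
\<close>

lemma banach_W: "banach_nspace W"
proof (rule W.banach_nspaceI)
  fix s :: "nat \<Rightarrow> nat \<Rightarrow> 'k"
  assume s: "\<And>n. s n \<in> vecs W"
    and Cauchy: "\<And>e. e > 0 \<Longrightarrow> \<exists>N. \<forall>m\<ge>N. \<forall>n\<ge>N. nrm W (s m - s n) < e"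
  have "convergent (\<lambda>n. s n i)" for i
  proof -
    have "Cauchy (\<lambda>n. s n i)"
      unfolding Cauchy_iff
    proof (intro allI impI)
      fix e :: real assume "e > 0"
      then obtain N where N: "\<And>m n. m \<ge> N \<Longrightarrow> n \<ge> N \<Longrightarrow> nrm W (s m - s n) < e * nrm E (\<xi> i)"
        using Cauchy[of "e * nrm E (\<xi> i)"] nrm_\<xi>_pos[of i] by auto
      have "norm (s m i - s n i) < e" if "m \<ge> N" "n \<ge> N" for m n
      proof -
        have "norm (s m i - s n i) * nrm E (\<xi> i) < e * nrm E (\<xi> i)"
          using coordinate_le[OF W.diff_vecs[OF s s], of m n i] N[OF that] by simp
        then show ?thesis
          using nrm_\<xi>_pos[of i] by simp
      qed
      then show "\<exists>N. \<forall>m\<ge>N. \<forall>n\<ge>N. norm (s m i - s n i) < e" by blast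
    qed
    then show ?thesis by (rule Cauchy_convergent)
  qed
  then obtain a where a: "\<And>i. (\<lambda>n. s n i) \<longlonglongrightarrow> a i"
    unfolding convergent_def by metis
  have unif: "\<exists>N. \<forall>n\<ge>N. \<forall>A. finite A \<longrightarrow> nrm E (combination (s n - a) A) \<le> e" if e: "e > 0" for e
  proof -
    obtain N where N: "\<And>m n. m \<ge> N \<Longrightarrow> n \<ge> N \<Longrightarrow> nrm W (s m - s n) < e"
      using Cauchy[OF e] by blast
    have "nrm E (combination (s n - a) A) \<le> e" if "n \<ge> N" "finite A" for n A
    proof (rule LIMSEQ_le_const2)
      show "(\<lambda>m. nrm E (combination (s n - s m) A)) \<longlonglongrightarrow> nrm E (combination (s n - a) A)"
        unfolding combination_def by (intro tendsto_nrm_combination) (auto intro!: tendsto_intros a)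
      show "\<exists>M. \<forall>m\<ge>M. nrm E (combination (s n - s m) A) \<le> e"
        using combination_le[OF W.diff_vecs[OF s s] that(2)] N[OF that(1)]
        by (meson less_imp_le order_trans)
    qed
    then show ?thesis by blast
  qed
  have aW: "a \<in> vecs W"
    unfolding vecs_W
  proof (intro allI impI)
    fix e :: real assume "e > 0"
    then obtain n where n: "\<And>A. finite A \<Longrightarrow> nrm E (combination (s n - a) A) \<le> e/2"
      using unif[of "e/2"] by auto
    obtain N where N: "\<And>A. finite A \<Longrightarrow> A \<subseteq> {N..} \<Longrightarrow> nrm E (combination (s n) A) \<le> e/2"
      using s[of n] \<open>e > 0\<close> unfolding vecs_W by (meson half_gt_zero)
    have "nrm E (combination a A) \<le> e" if "finite A" "A \<subseteq> {N..}" for A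
      using nrm_diff[of "combination (s n) A" "combination (s n - a) A"] n[OF that(1)] N[OF that]
      by (simp add: combination_diff)
    then show "\<exists>N. \<forall>A. finite A \<and> A \<subseteq> {N..} \<longrightarrow> nrm E (combination a A) \<le> e" by blast
  qed
  have "(\<lambda>n. nrm W (s n - a)) \<longlonglongrightarrow> 0"
  proof (rule LIMSEQ_I)
    fix e :: real assume "e > 0"
    then obtain N where "\<And>n A. n \<ge> N \<Longrightarrow> finite A \<Longrightarrow> nrm E (combination (s n - a) A) \<le> e/2"
      using unif[of "e/2"] by auto
    then have "nrm W (s n - a) \<le> e/2" if "n \<ge> N" for n
      using that by (intro nrm_W_le) auto
    then show "\<exists>N. \<forall>n\<ge>N. norm (nrm W (s n - a) - 0) < e"
      using \<open>e > 0\<close> W.nrm_nonneg[OF W.diff_vecs[OF s aW]] by (intro exI[of _ N]) fastforce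
  qed
  with aW show "\<exists>a\<in>vecs W. (\<lambda>n. nrm W (s n - a)) \<longlonglongrightarrow> 0" by blast
qed

text \<open>
  The finite sets \<open>G m\<close> need not increase. This is what makes every rearrangement of the expansion in unit
  sequences converge: the index sets of its partial sums eventually contain each given index.
\<close>

lemma truncations_tendsto:
  assumes a: "a \<in> vecs W" and G: "\<And>m. finite (G m)"
    and cover: "\<And>n. \<forall>\<^sub>F m in sequentially. n \<in> G m"
  shows "limitin (ntopology W) (\<lambda>m i. if i \<in> G m then a i else 0) a sequentially"
proof -
  have trunc: "(\<lambda>i. if i \<in> G m then a i else 0) \<in> vecs W" for m
    by (rule finite_support_vecs_W) (auto intro: finite_subset[OF _ G[of m]])
  have "(\<lambda>m. nrm W ((\<lambda>i. if i \<in> G m then a i else 0) - a)) \<longlonglongrightarrow> 0"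
  proof (rule tendstoI)
    fix e :: real assume "e > 0"
    then obtain N where N: "\<And>A. finite A \<Longrightarrow> A \<subseteq> {N..} \<Longrightarrow> nrm E (combination a A) \<le> e/2"
      using a unfolding vecs_W by (meson half_gt_zero)
    have "\<forall>\<^sub>F m in sequentially. \<forall>n\<in>{..<N}. n \<in> G m"
      using cover by (intro eventually_ball_finite) auto
    then show "\<forall>\<^sub>F m in sequentially. dist (nrm W ((\<lambda>i. if i \<in> G m then a i else 0) - a)) 0 < e"
    proof eventually_elim
      case (elim m)
      let ?d = "(\<lambda>i. if i \<in> G m then a i else 0) - a"
      have "nrm W ?d \<le> e/2"
      proof (rule nrm_W_le)
        fix A :: "nat set" assume A: "finite A"
        have "combination ?d A = combination ?d (A - G m)"
          unfolding combination_def using A by (intro sum.mono_neutral_right) auto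
        also have "\<dots> = 0 - combination a (A - G m)"
          unfolding combination_def sum_negf[symmetric] by (auto intro!: sum.cong simp: sum_negf[symmetric])
        finally have "nrm E (combination ?d A) = nrm E (combination a (A - G m))"
          using nrm_commute[of 0 "combination a (A - G m)"] by simp
        also have "\<dots> \<le> e/2"
          using A elim by (intro N) (auto simp: not_less[symmetric])
        finally show "nrm E (combination ?d A) \<le> e/2" .
      qed
      then show ?case
        using W.nrm_nonneg[OF W.diff_vecs[OF trunc a], of m] \<open>e > 0\<close> by simp
    qed
  qed
  then show ?thesis
    using W.limitin_iff[of "\<lambda>m i. if i \<in> G m then a i else 0", OF trunc] a by blast
qed

lemma sum_unit_sequences:
  assumes "finite G" "\<And>n. n \<in> G \<Longrightarrow> n \<ge> 1"
  shows "(\<Sum>n\<in>G. smul W (b n) (unit_sequence n)) = (\<lambda>i. if Suc i \<in> G then b (Suc i) else 0)"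
proof
  fix i
  have "(\<Sum>n\<in>G. smul W (b n) (unit_sequence n)) i = (\<Sum>n\<in>G. if n = Suc i then b n else 0)"
    unfolding sum_function_apply using assms(2)
    by (intro sum.cong) (force simp: smul_W unit_sequence_def)+
  then show "(\<Sum>n\<in>G. smul W (b n) (unit_sequence n)) i = (if Suc i \<in> G then b (Suc i) else 0)"
    using assms(1) by simp
qed

lemma unit_sequence_vecs_W: "unit_sequence n \<in> vecs W"
  by (rule finite_support_vecs_W) (simp add: unit_sequence_def)

lemma unit_sequence_expansion:
  assumes b: "series_sums W {1..} (\<lambda>n. smul W (b n) (unit_sequence n)) a"
  shows "b (Suc i) = a i"
proof -
  let ?s = "\<lambda>m. \<Sum>n\<in>{1..} \<inter> {..m}. smul W (b n) (unit_sequence n)"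
  have s: "?s m \<in> vecs W" for m
    by (intro W.sum_vecs W.smul_vecs unit_sequence_vecs_W)
  then have a: "a \<in> vecs W" and lim: "(\<lambda>m. nrm W (?s m - a)) \<longlonglongrightarrow> 0"
    using b unfolding series_sums_def W.limitin_iff[of ?s, OF s] by auto
  have le: "norm (b (Suc i) - a i) * nrm E (\<xi> i) \<le> nrm W (?s m - a)" if "m \<ge> Suc i" for m
  proof -
    have "?s m i = b (Suc i)"
      using that by (subst sum_unit_sequences) auto
    then show ?thesis
      using coordinate_le[OF W.diff_vecs[OF s a], of m i] by simp
  qed
  have "norm (b (Suc i) - a i) * nrm E (\<xi> i) \<le> 0"
    using LIMSEQ_le_const[OF lim] le by blast
  then show ?thesis
    using nrm_\<xi>_pos[of i] by (simp add: mult_le_0_iff)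
qed

theorem unconditional_schauder_basis_unit_sequences:
  "unconditional_schauder_basis W {1..} unit_sequence"
proof -
  \<comment> \<open>The identity permutation gives the expansion itself.\<close>
  have rearranged: "series_sums W {1..} (\<lambda>n. smul W (b (\<pi> n)) (unit_sequence (\<pi> n))) a"
    if \<pi>: "bij_betw \<pi> {1..} {1..}" and b: "\<And>i. b (Suc i) = a i" and a: "a \<in> vecs W" for \<pi> b a
  proof -
    let ?G = "\<lambda>m. \<pi> ` ({1..} \<inter> {..m})"
    have "(\<Sum>n\<in>{1..} \<inter> {..m}. smul W (b (\<pi> n)) (unit_sequence (\<pi> n))) =
        (\<lambda>i. if i \<in> {i. Suc i \<in> ?G m} then a i else 0)" for m
    proof -
      have "inj_on \<pi> ({1..} \<inter> {..m})"
        using \<pi> by (meson bij_betw_def inf_le1 inj_on_subset)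
      then have "(\<Sum>n\<in>{1..} \<inter> {..m}. smul W (b (\<pi> n)) (unit_sequence (\<pi> n))) =
          (\<Sum>n\<in>?G m. smul W (b n) (unit_sequence n))"
        by (simp add: sum.reindex)
      also have "\<dots> = (\<lambda>i. if Suc i \<in> ?G m then b (Suc i) else 0)"
        using bij_betwE[OF \<pi>] by (intro sum_unit_sequences) auto
      finally show ?thesis by (simp add: b fun_eq_iff)
    qed
    moreover have "limitin (ntopology W) (\<lambda>m i. if i \<in> {i. Suc i \<in> ?G m} then a i else 0) a sequentially"
    proof (rule truncations_tendsto[OF a])
      show "finite {i. Suc i \<in> ?G m}" for m
        using finite_vimageI[of "?G m" Suc] by (simp add: vimage_def)
      show "\<forall>\<^sub>F m in sequentially. n \<in> {i. Suc i \<in> ?G m}" for n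
      proof -
        have "Suc n \<in> \<pi> ` {1..}"
          using \<pi> by (simp add: bij_betw_def)
        then obtain k where k: "k \<ge> 1" "\<pi> k = Suc n"
          by force
        have "\<forall>\<^sub>F m in sequentially. m \<ge> k"
          by (rule eventually_ge_at_top)
        then show ?thesis
          by eventually_elim (use k in \<open>force simp: image_iff\<close>)
      qed
    qed
    ultimately show ?thesis
      by (simp add: series_sums_def)
  qed
  have "\<exists>!b. b \<in> extensional {1..} \<and> series_sums W {1..} (\<lambda>n. smul W (b n) (unit_sequence n)) a"
    if a: "a \<in> vecs W" for a
  proof (rule ex1I)
    show "restrict (\<lambda>n. a (n - 1)) {1..} \<in> extensional {1..} \<and>
        series_sums W {1..} (\<lambda>n. smul W (restrict (\<lambda>n. a (n - 1)) {1..} n) (unit_sequence n)) a"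
      using rearranged[of id "restrict (\<lambda>n. a (n - 1)) {1..}" a] a by simp
    fix b assume b: "b \<in> extensional {1..} \<and> series_sums W {1..} (\<lambda>n. smul W (b n) (unit_sequence n)) a"
    show "b = restrict (\<lambda>n. a (n - 1)) {1..}"
    proof (rule extensionalityI)
      fix n :: nat assume "n \<in> {1..}"
      then show "b n = restrict (\<lambda>n. a (n - 1)) {1..} n"
        using unit_sequence_expansion[of b a "n - 1"] b by simp
    qed (use b in auto)
  qed
  then have "schauder_basis W {1..} unit_sequence"
    by (simp add: schauder_basis_def unit_sequence_vecs_W)
  moreover have "unconditionally_convergent W {1..} (\<lambda>n. smul W (b n) (unit_sequence n))"
    if "a \<in> vecs W" "series_sums W {1..} (\<lambda>n. smul W (b n) (unit_sequence n)) a" for a b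
    unfolding unconditionally_convergent_def
    using rearranged[of _ b a] unit_sequence_expansion[OF that(2)] that(1) by blast
  ultimately show ?thesis
    by (simp add: unconditional_schauder_basis_def)
qed

definition synthesis :: "(nat \<Rightarrow> 'k) \<Rightarrow> 'a" where
  "synthesis a = (THE v. limitin (ntopology E) (\<lambda>m. combination a {..<m}) v sequentially)"

lemma limitin_synthesis:
  assumes a: "a \<in> vecs W"
  shows "limitin (ntopology E) (\<lambda>m. combination a {..<m}) (synthesis a) sequentially"
proof -
  have "\<exists>N. \<forall>m\<ge>N. \<forall>n\<ge>N. nrm E (combination a {..<m} - combination a {..<n}) < e" if e: "e > 0" for e
  proof -
    obtain N where N: "\<And>A. finite A \<Longrightarrow> A \<subseteq> {N..} \<Longrightarrow> nrm E (combination a A) \<le> e/2"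
      using a e unfolding vecs_W by (meson half_gt_zero)
    have le: "nrm E (combination a {..<m} - combination a {..<n}) < e" if "n \<ge> N" "m \<ge> n" for m n
    proof -
      have "combination a {..<m} - combination a {..<n} = combination a {n..<m}"
        unfolding combination_def using that(2) by (simp add: lessThan_atLeast0 sum_diff_nat_ivl)
      then show ?thesis
        using N[of "{n..<m}"] that(1) e by fastforce
    qed
    have "nrm E (combination a {..<m} - combination a {..<n}) < e" if "n \<ge> N" "m \<ge> N" for m n
      using le[OF that(1), of m] le[OF that(2), of n]
        nrm_commute[of "combination a {..<m}" "combination a {..<n}"] by (cases "m \<ge> n") auto
    then show ?thesis by blast
  qed
  then obtain v where v: "limitin (ntopology E) (\<lambda>m. combination a {..<m}) v sequentially"
    by (rule Cauchy_limit[OF combination_vecs])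
  then show ?thesis
    unfolding synthesis_def by (rule theI) (rule limitin_unique[OF _ v])
qed

lemma synthesis_eqI:
  "a \<in> vecs W \<Longrightarrow> limitin (ntopology E) (\<lambda>m. combination a {..<m}) v sequentially \<Longrightarrow> synthesis a = v"
  using limitin_synthesis limitin_unique by blast

lemma bounded_operator_synthesis: "bounded_operator W E synthesis"
  unfolding bounded_operator_def
proof (intro conjI ballI allI)
  have vecs: "synthesis a \<in> vecs E"
    and lim: "(\<lambda>m. nrm E (combination a {..<m} - synthesis a)) \<longlonglongrightarrow> 0" if "a \<in> vecs W" for a
    using limitin_synthesis[OF that] limitin_iff[of "\<lambda>m. combination a {..<m}"] by auto
  show "synthesis ` vecs W \<subseteq> vecs E"
    using vecs by blast
  show "synthesis (a + b) = synthesis a + synthesis b" if a: "a \<in> vecs W" and b: "b \<in> vecs W" for a b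
  proof (rule synthesis_eqI[OF vecs_W_add[OF a b]])
    have "nrm E (combination (a + b) {..<m} - (synthesis a + synthesis b)) \<le>
        nrm E (combination a {..<m} - synthesis a) + nrm E (combination b {..<m} - synthesis b)" for m
      using nrm_add[of "combination a {..<m} - synthesis a" "combination b {..<m} - synthesis b"] vecs a b
      by (simp add: combination_add algebra_simps)
    then have "(\<lambda>m. nrm E (combination (a + b) {..<m} - (synthesis a + synthesis b))) \<longlonglongrightarrow> 0"
      using vecs a b
      by (intro tendsto_sandwich[OF _ _ tendsto_const tendsto_add_zero[OF lim[OF a] lim[OF b]]]
          always_eventually allI) simp_all
    then show "limitin (ntopology E) (\<lambda>m. combination (a + b) {..<m}) (synthesis a + synthesis b) sequentially"
      using vecs a b by (subst limitin_iff) auto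
  qed
  show "synthesis (smul W c a) = smul E c (synthesis a)" if a: "a \<in> vecs W" for a c
    unfolding smul_W
  proof (rule synthesis_eqI[OF vecs_W_scale[OF a]])
    have "nrm E (combination (\<lambda>n. c * a n) {..<m} - smul E c (synthesis a)) =
        norm c * nrm E (combination a {..<m} - synthesis a)" for m
      using vecs a by (simp add: combination_scale vs.scale_right_diff_distrib[symmetric])
    then show "limitin (ntopology E) (\<lambda>m. combination (\<lambda>n. c * a n) {..<m}) (smul E c (synthesis a)) sequentially"
      using vecs a tendsto_mult_right_zero[OF lim[OF a], of "norm c"] by (subst limitin_iff) auto
  qed
  have "nrm E (synthesis a) \<le> 1 * nrm W a" if a: "a \<in> vecs W" for a
  proof (rule LIMSEQ_le_const)
    show "(\<lambda>m. 1 * nrm W a + nrm E (combination a {..<m} - synthesis a)) \<longlonglongrightarrow> 1 * nrm W a"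
      using tendsto_add[OF tendsto_const lim[OF a]] by simp
    have "nrm E (synthesis a) \<le> 1 * nrm W a + nrm E (combination a {..<m} - synthesis a)" for m
      using nrm_diff[of "combination a {..<m}" "combination a {..<m} - synthesis a"]
        combination_le[OF a, of "{..<m}"] vecs[OF a] by simp
    then show "\<exists>N. \<forall>m\<ge>N. nrm E (synthesis a) \<le> 1 * nrm W a + nrm E (combination a {..<m} - synthesis a)"
      by blast
  qed
  then show "\<exists>B. \<forall>a\<in>vecs W. nrm E (synthesis a) \<le> B * nrm W a"
    by blast
qed

end

section \<open>Equivalent norms and the isometric embedding\<close>

lemma limitin_dominated_norm:
  assumes "normed_nspace V" "normed_nspace W" and vecs: "vecs W = vecs V"
    and le: "\<And>x. x \<in> vecs V \<Longrightarrow> nrm W x \<le> C * nrm V x" and "C > 0"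
    and lim: "limitin (ntopology V) s x sequentially"
  shows "limitin (ntopology W) s x sequentially"
proof -
  interpret V: normed_nspace V by fact
  interpret W: normed_nspace W by fact
  have x: "x \<in> vecs V" and V: "\<And>e. e > 0 \<Longrightarrow> \<exists>N. \<forall>n\<ge>N. s n \<in> vecs V \<and> ndist V (s n) x < e"
    using lim unfolding V.ms.limit_metric_sequentially by auto
  have dist: "ndist W y x \<le> C * ndist V y x" if "y \<in> vecs V" for y
    using le[of "y - x"] that x by (simp add: ndist_def vecs)
  show ?thesis
    unfolding W.ms.limit_metric_sequentially
  proof (intro conjI allI impI)
    fix e :: real assume "e > 0"
    then obtain N where N: "\<And>n. n \<ge> N \<Longrightarrow> s n \<in> vecs V \<and> ndist V (s n) x < e / C"
      using V[of "e / C"] \<open>C > 0\<close> by auto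
    have "s n \<in> vecs W \<and> ndist W (s n) x < e" if "n \<ge> N" for n
    proof -
      have "C * ndist V (s n) x < e"
        using N[OF that] \<open>C > 0\<close> by (simp add: pos_less_divide_eq mult.commute)
      then show ?thesis
        using dist[of "s n"] N[OF that] by (simp add: vecs)
    qed
    then show "\<exists>N. \<forall>n\<ge>N. s n \<in> vecs W \<and> ndist W (s n) x < e" by blast
  qed (simp add: x vecs)
qed

lemma equivalent_norm:
  fixes V W :: "('k::{real_normed_field,banach}, 'a::ab_group_add) nspace"
  assumes V: "banach_nspace V" and W: "normed_nspace W"
    and vecs: "vecs W = vecs V" and smul: "smul W = smul V"
    and WV: "\<And>x. x \<in> vecs V \<Longrightarrow> nrm W x \<le> C * nrm V x" "C > 0"
    and VW: "\<And>x. x \<in> vecs V \<Longrightarrow> nrm V x \<le> D * nrm W x" "D > 0"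
  shows "banach_nspace W"
    and "unconditional_schauder_basis W I e \<longleftrightarrow> unconditional_schauder_basis V I e"
proof -
  interpret V: banach_nspace V by fact
  interpret W: normed_nspace W by fact
  have lim: "limitin (ntopology W) s x sequentially \<longleftrightarrow> limitin (ntopology V) s x sequentially"
    for s :: "nat \<Rightarrow> 'a" and x
    using limitin_dominated_norm[OF V.normed_nspace_axioms W vecs WV]
      limitin_dominated_norm[OF W V.normed_nspace_axioms vecs[symmetric] VW[folded vecs]] by blast
  show "banach_nspace W"
  proof (rule W.banach_nspaceI)
    fix s :: "nat \<Rightarrow> 'a"
    assume s: "\<And>n. s n \<in> vecs W"
      and Cauchy: "\<And>e. e > 0 \<Longrightarrow> \<exists>N. \<forall>m\<ge>N. \<forall>n\<ge>N. nrm W (s m - s n) < e"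
    have "\<exists>N. \<forall>m\<ge>N. \<forall>n\<ge>N. nrm V (s m - s n) < e" if "e > 0" for e
    proof -
      obtain N where N: "\<And>m n. m \<ge> N \<Longrightarrow> n \<ge> N \<Longrightarrow> nrm W (s m - s n) < e / D"
        using Cauchy[of "e / D"] \<open>e > 0\<close> VW(2) by auto
      have "nrm V (s m - s n) < e" if "m \<ge> N" "n \<ge> N" for m n
        using N[OF that] VW(1)[of "s m - s n"] VW(2) s[unfolded vecs]
        by (simp add: pos_less_divide_eq mult.commute)
      then show ?thesis by blast
    qed
    then obtain x where "limitin (ntopology V) s x sequentially"
      using V.Cauchy_limit[of s] s[unfolded vecs] by blast
    then show "\<exists>x\<in>vecs W. (\<lambda>n. nrm W (s n - x)) \<longlonglongrightarrow> 0"
      using W.limitin_iff[of s, OF s] lim by blast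
  qed
  have "series_sums W = series_sums V"
    by (intro ext) (simp add: series_sums_def lim)
  then show "unconditional_schauder_basis W I e \<longleftrightarrow> unconditional_schauder_basis V I e"
    by (simp add: unconditional_schauder_basis_def schauder_basis_def unconditionally_convergent_def
        vecs smul)
qed

text \<open>
  \<open>P = J \<circ> Q\<close> is a bounded projection onto the range of \<open>J\<close>. The norm of \<open>w\<close> is replaced by that of
  \<open>Q w\<close> in \<open>E\<close> plus that of \<open>w - P w\<close>; on the range of \<open>J\<close> the second summand vanishes, so that \<open>J\<close> becomes
  isometric. Boundedness of \<open>J\<close> and \<open>Q\<close> makes the new norm equivalent to the old one.
\<close>

lemma isometric_renorming:
  fixes E :: "('k::{real_normed_field,banach}, 'a::ab_group_add) nspace"
    and V :: "('k, 'b::ab_group_add) nspace"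
  assumes E: "banach_nspace E" and V: "banach_nspace V"
    and J: "bounded_operator E V J" and Q: "bounded_operator V E Q"
    and QJ: "\<And>v. v \<in> vecs E \<Longrightarrow> Q (J v) = v"
    and basis: "unconditional_schauder_basis V I e"
  shows "\<exists>(W :: ('k, 'b) nspace) S. banach_space W \<and> (\<exists>I e. unconditional_schauder_basis W I e) \<and>
    complemented_subspace W S \<and> isometrically_isomorphic E (W\<lparr>vecs := S\<rparr>)"
proof -
  interpret E: banach_nspace E by fact
  interpret V: banach_nspace V by fact
  note En = E.normed_nspace_axioms and Vn = V.normed_nspace_axioms
  have J_vecs: "J v \<in> vecs V" if "v \<in> vecs E" for v
    using J that by (auto simp: bounded_operator_def)
  have Q_vecs: "Q w \<in> vecs E" if "w \<in> vecs V" for w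
    using Q that by (auto simp: bounded_operator_def)
  have J_add: "J (u + v) = J u + J v" if "u \<in> vecs E" "v \<in> vecs E" for u v
    using J that by (auto simp: bounded_operator_def)
  have Q_add: "Q (u + v) = Q u + Q v" if "u \<in> vecs V" "v \<in> vecs V" for u v
    using Q that by (auto simp: bounded_operator_def)
  have J_smul: "J (smul E c v) = smul V c (J v)" if "v \<in> vecs E" for c v
    using J that by (auto simp: bounded_operator_def)
  have Q_smul: "Q (smul V c w) = smul E c (Q w)" if "w \<in> vecs V" for c w
    using Q that by (auto simp: bounded_operator_def)
  note J_0 = bounded_operator_zero[OF En J] and Q_0 = bounded_operator_zero[OF Vn Q]
  obtain b where b: "b \<ge> 0" "\<And>v. v \<in> vecs E \<Longrightarrow> nrm V (J v) \<le> b * nrm E v"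
    using bounded_operator_bound[OF En J] by blast
  obtain q where q: "q \<ge> 0" "\<And>w. w \<in> vecs V \<Longrightarrow> nrm E (Q w) \<le> q * nrm V w"
    using bounded_operator_bound[OF Vn Q] by blast
  define P where "P w = J (Q w)" for w
  have P: "P w \<in> vecs V" if "w \<in> vecs V" for w
    using that by (simp add: P_def J_vecs Q_vecs)
  define W where "W = V\<lparr>nrm := \<lambda>w. nrm E (Q w) + nrm V (w - P w)\<rparr>"
  have [simp]: "vecs W = vecs V" "smul W = smul V"
    and nrm_W: "nrm W w = nrm E (Q w) + nrm V (w - P w)" for w
    by (simp_all add: W_def)
  have WV: "nrm W w \<le> (q + 1 + b * q) * nrm V w" if w: "w \<in> vecs V" for w
  proof -
    have "nrm V (P w) \<le> b * (q * nrm V w)"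
      using b(2)[OF Q_vecs[OF w]] mult_left_mono[OF q(2)[OF w] b(1)] by (simp add: P_def)
    then show ?thesis
      using q(2)[OF w] V.nrm_diff[OF w P[OF w]] by (simp add: nrm_W algebra_simps)
  qed
  have VW: "nrm V w \<le> (b + 1) * nrm W w" if w: "w \<in> vecs V" for w
  proof -
    have "nrm V w \<le> nrm V (P w) + nrm V (w - P w)"
      using V.nrm_add[OF P[OF w] V.diff_vecs[OF w P[OF w]]] by simp
    also have "\<dots> \<le> b * nrm E (Q w) + nrm V (w - P w)"
      using b(2)[OF Q_vecs[OF w]] by (simp add: P_def)
    also have "\<dots> \<le> (b + 1) * nrm W w"
      using b(1) E.nrm_nonneg[OF Q_vecs[OF w]] V.nrm_nonneg[OF V.diff_vecs[OF w P[OF w]]]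
      by (simp add: nrm_W algebra_simps)
    finally show ?thesis .
  qed
  have normed: "normed_space W"
    unfolding normed_space_def
  proof (intro conjI ballI allI)
    show "vector_space (smul W)" by (simp add: V.vs.vector_space_axioms)
    show "module.subspace (smul W) (vecs W)" by (simp add: V.subspace_vecs)
    fix w assume w: "w \<in> vecs W"
    show nonneg: "0 \<le> nrm W w"
      using w by (simp add: nrm_W Q_vecs P)
    show "nrm W w = 0 \<longleftrightarrow> w = 0"
    proof
      assume "nrm W w = 0"
      then have "nrm V w \<le> 0" using VW[of w] w by simp
      then show "w = 0"
        using V.nrm_nonneg[of w] V.nrm_eq_0[of w] w by fastforce
    qed (simp add: nrm_W P_def Q_0 J_0)
    show "nrm W (smul W c w) = norm c * nrm W w" for c
    proof -
      have "smul V c w - P (smul V c w) = smul V c (w - P w)"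
        using w by (simp add: P_def Q_smul Q_vecs J_smul V.vs.scale_right_diff_distrib)
      then show ?thesis
        using w by (simp add: nrm_W Q_smul Q_vecs P distrib_left)
    qed
    fix z assume z: "z \<in> vecs W"
    have sum_eq: "w + z - P (w + z) = (w - P w) + (z - P z)"
      using w z by (simp add: P_def Q_add Q_vecs J_add)
    show "nrm W (w + z) \<le> nrm W w + nrm W z"
      using w z E.nrm_add[of "Q w" "Q z"] V.nrm_add[of "w - P w" "z - P z"]
      unfolding nrm_W sum_eq by (simp add: Q_add Q_vecs P)
  qed
  then have Wn: "normed_nspace W"
    by (rule normed_nspace.intro)
  have pos: "q + 1 + b * q > 0" "b + 1 > 0"
    using b(1) q(1) by (simp_all add: add_pos_nonneg add_nonneg_pos)
  note eq = equivalent_norm[OF V Wn _ _ WV pos(1) VW pos(2)]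
  have "banach_space W"
    unfolding banach_space_iff by (rule eq(1)) simp_all
  moreover have "unconditional_schauder_basis W I e"
    by (rule iffD2[OF eq(2) basis]) simp_all
  moreover have "complemented_subspace W (J ` vecs E)"
    unfolding complemented_subspace_def
  proof (intro exI[of _ P] conjI ballI)
    show "bounded_operator W W P"
      unfolding bounded_operator_def
    proof (intro conjI ballI allI exI[of _ 1])
      show "nrm W (P w) \<le> 1 * nrm W w" if "w \<in> vecs W" for w
        using that by (simp add: nrm_W P_def QJ Q_vecs J_vecs)
    qed (auto simp: P_def Q_vecs J_vecs Q_add J_add Q_smul J_smul)
    show "P (P w) = P w" if "w \<in> vecs W" for w
      using that by (simp add: P_def QJ Q_vecs)
    have "J v \<in> P ` vecs W" if "v \<in> vecs E" for v
      using that by (intro image_eqI[of _ _ "J v"]) (simp_all add: P_def QJ J_vecs)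
    then show "P ` vecs W = J ` vecs E"
      by (auto simp: P_def Q_vecs)
  qed
  moreover have "isometrically_isomorphic E (W\<lparr>vecs := J ` vecs E\<rparr>)"
    unfolding isometrically_isomorphic_def
  proof (intro exI[of _ J] conjI ballI)
    have iso: "nrm W (J v) = nrm E v" if "v \<in> vecs E" for v
      using that by (simp add: nrm_W P_def QJ)
    show "nrm (W\<lparr>vecs := J ` vecs E\<rparr>) (J v) = nrm E v" if "v \<in> vecs E" for v
      using iso[OF that] by simp
    show "bij_betw J (vecs E) (vecs (W\<lparr>vecs := J ` vecs E\<rparr>))"
      using QJ by (auto simp: bij_betw_def intro: inj_on_inverseI)
    show "bounded_operator E (W\<lparr>vecs := J ` vecs E\<rparr>) J"
      unfolding bounded_operator_def using J_add J_smul iso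
      by (auto intro!: exI[of _ 1])
  qed
  ultimately show ?thesis by blast
qed

section \<open>Besselian frames\<close>

lemma banach_nspace_scalars: "banach_nspace (scalars :: ('k::{real_normed_field,banach}, 'k) nspace)"
proof -
  have "normed_space (scalars :: ('k, 'k) nspace)"
    unfolding normed_space_def scalars_def
  proof (intro conjI)
    show vs: "vector_space (smul \<lparr>vecs = UNIV :: 'k set, smul = (*), nrm = norm\<rparr>)"
      by unfold_locales (simp_all add: algebra_simps)
    interpret vector_space "(*) :: 'k \<Rightarrow> 'k \<Rightarrow> 'k"
      using vs by simp
    show "module.subspace (smul \<lparr>vecs = UNIV :: 'k set, smul = (*), nrm = norm\<rparr>)
        (vecs \<lparr>vecs = UNIV :: 'k set, smul = (*), nrm = norm\<rparr>)"
      by (simp add: subspace_UNIV)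
  qed (auto simp: norm_mult norm_triangle_ineq)
  then have "normed_nspace (scalars :: ('k, 'k) nspace)"
    by (rule normed_nspace.intro)
  then show ?thesis
  proof (rule normed_nspace.banach_nspaceI)
    fix s :: "nat \<Rightarrow> 'k"
    assume "\<And>e. e > 0 \<Longrightarrow> \<exists>N. \<forall>m\<ge>N. \<forall>n\<ge>N. nrm scalars (s m - s n) < e"
    then have "Cauchy s"
      by (simp add: Cauchy_iff scalars_def)
    then obtain x where "s \<longlonglongrightarrow> x"
      using Cauchy_convergent convergent_def by blast
    then show "\<exists>x\<in>vecs scalars. (\<lambda>n. nrm scalars (s n - x)) \<longlonglongrightarrow> 0"
      by (auto simp: scalars_def intro!: exI[of _ x] LIM_zero tendsto_norm_zero)
  qed
qed

text \<open>
  A frame may have a finite index set or contain zero vectors. At such indices, and at index 0, the vector is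
  replaced by a fixed nonzero one and the functional by zero, which changes neither the expansions nor
  the sums in the Bessel condition.
\<close>

lemma (in normed_nspace) besselian_schauder_frame_normalize:
  assumes frame: "besselian_schauder_frame E I x y" and u: "u \<in> vecs E" "u \<noteq> 0"
  obtains \<xi> \<eta> where "\<And>n. \<xi> n \<in> vecs E" "\<And>n. \<xi> n \<noteq> 0" "\<And>n. \<eta> n \<in> dual E"
    and "\<And>v. v \<in> vecs E \<Longrightarrow> limitin (ntopology E) (\<lambda>m. \<Sum>n<m. smul E (\<eta> n v) (\<xi> n)) v sequentially"
    and "\<And>v f. v \<in> vecs E \<Longrightarrow> f \<in> dual E \<Longrightarrow> summable (\<lambda>n. norm (\<eta> n v) * norm (f (\<xi> n)))"
proof -
  have xy: "x n \<in> vecs E" "y n \<in> dual E" if "n \<in> I" for n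
    using frame that by (auto simp: besselian_schauder_frame_def schauder_frame_def)
  define Z where "Z = {n \<in> I. x n \<noteq> 0}"
  define \<xi> where "\<xi> n = (if n \<in> Z then x n else u)" for n
  define \<eta> where "\<eta> n = (if n \<in> Z then y n else (\<lambda>_. 0))" for n
  have zero: "(\<lambda>_. 0) \<in> dual E"
    by (auto simp: dual_def bounded_operator_def scalars_def intro: exI[of _ 0])
  show thesis
  proof (rule that[of \<xi> \<eta>])
    show \<xi>: "\<xi> n \<in> vecs E" and "\<xi> n \<noteq> 0" and "\<eta> n \<in> dual E" for n
      using xy u zero by (auto simp: \<xi>_def \<eta>_def Z_def)
    fix v assume v: "v \<in> vecs E"
    let ?s = "\<lambda>m. \<Sum>n<m. smul E (\<eta> n v) (\<xi> n)"
    have s: "?s m \<in> vecs E" for m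
      by (simp add: \<xi>)
    have eq: "?s (Suc m) = (\<Sum>n\<in>I \<inter> {..m}. smul E (y n v) (x n))" for m
      unfolding lessThan_Suc_atMost
      by (intro sum.mono_neutral_cong) (auto simp: \<xi>_def \<eta>_def Z_def)
    have "limitin (ntopology E) (\<lambda>m. ?s (Suc m)) v sequentially"
      unfolding eq
      using frame v by (simp add: besselian_schauder_frame_def schauder_frame_def series_sums_def)
    then have "(\<lambda>m. nrm E (?s (Suc m) - v)) \<longlonglongrightarrow> 0"
      using limitin_iff[of "\<lambda>m. ?s (Suc m)", OF s] by blast
    then have "(\<lambda>m. nrm E (?s m - v)) \<longlonglongrightarrow> 0"
      by (rule LIMSEQ_imp_Suc)
    then show "limitin (ntopology E) ?s v sequentially"
      using limitin_iff[of ?s, OF s] v by blast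
    fix f assume f: "f \<in> dual E"
    have "(\<lambda>n. norm (y n v) * norm (f (x n))) summable_on I"
      using frame v f by (auto simp: besselian_schauder_frame_def)
    moreover have "(\<lambda>n. norm (\<eta> n v) * norm (f (\<xi> n))) summable_on UNIV \<longleftrightarrow>
        (\<lambda>n. norm (y n v) * norm (f (x n))) summable_on I"
      by (rule summable_on_cong_neutral) (auto simp: \<xi>_def \<eta>_def Z_def dual_zero[OF f])
    ultimately have "(\<lambda>n. norm (\<eta> n v) * norm (f (\<xi> n))) summable_on UNIV"
      by blast
    then show "summable (\<lambda>n. norm (\<eta> n v) * norm (f (\<xi> n)))"
      by (simp add: summable_on_UNIV_nonneg_real_iff)
  qed
qed

text \<open>
  Frame expansions converge unconditionally, so coefficient sequences do belong to the space. Their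
  norm is the supremum of the norms of the operators \<open>v \<mapsto> combination (\<lambda>n. \<eta> n v) A\<close> at \<open>v\<close>, over finite \<open>A\<close>;
  hence boundedness is the uniform boundedness principle for this family.
\<close>

lemma embedding_into_unconditional_coefficients:
  fixes E :: "('k::{real_normed_field,banach}, 'a::ab_group_add) nspace"
  assumes "nonzero_sequence E \<xi>" and wsc: "weakly_seq_complete E"
    and \<eta>: "\<And>n. \<eta> n \<in> dual E"
    and frame: "\<And>v. v \<in> vecs E \<Longrightarrow>
      limitin (ntopology E) (\<lambda>m. \<Sum>n<m. smul E (\<eta> n v) (\<xi> n)) v sequentially"
    and wuc: "\<And>v f. v \<in> vecs E \<Longrightarrow> f \<in> dual E \<Longrightarrow> summable (\<lambda>n. norm (\<eta> n v) * norm (f (\<xi> n)))"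
  shows "bounded_operator E (unconditional_coefficients E \<xi>) (\<lambda>v n. \<eta> n v)"
proof -
  interpret nonzero_sequence E \<xi> by fact
  let ?J = "\<lambda>v n. \<eta> n v"
  have J: "?J v \<in> vecs W" if v: "v \<in> vecs E" for v
  proof -
    have "unconditionally_Cauchy E (\<lambda>n. smul E (\<eta> n v) (\<xi> n))"
    proof (rule weakly_unconditionally_Cauchy_imp_unconditionally_Cauchy[OF wsc \<xi>_vecs \<eta>])
      show "(\<lambda>m. nrm E ((\<Sum>n<m. smul E (\<eta> n w) (\<xi> n)) - w)) \<longlonglongrightarrow> 0" if "w \<in> vecs E" for w
        using frame[OF that] limitin_iff[of "\<lambda>m. \<Sum>n<m. smul E (\<eta> n w) (\<xi> n)"] by simp
      show "summable (\<lambda>l. norm (f (smul E (\<eta> l v) (\<xi> l))))" if "f \<in> dual E" for f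
        using wuc[OF v that] by (simp add: dual_smul[OF that] norm_mult)
    qed simp
    then show ?thesis
      by (simp add: unconditional_coefficients_def)
  qed
  have combination_J_add: "combination (?J (v + w)) A = combination (?J v) A + combination (?J w) A"
    if "v \<in> vecs E" "w \<in> vecs E" for v w A
    using that by (simp add: combination_def dual_add \<eta> vs.scale_left_distrib sum.distrib)
  have combination_J_smul: "combination (?J (smul E c v)) A = smul E c (combination (?J v) A)"
    if "v \<in> vecs E" for c v A
    using that by (simp add: combination_def dual_smul \<eta> vs.scale_sum_right)
  let ?T = "(\<lambda>A v. combination (?J v) A) ` Collect finite"
  have T: "bounded_operator E E T" if T_in: "T \<in> ?T" for T
  proof -
    obtain A where T_eq: "T = (\<lambda>v. combination (?J v) A)"
      using T_in by blast
    have "\<exists>B. \<forall>n. \<forall>v\<in>vecs E. norm (\<eta> n v) \<le> B n * nrm E v"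
      by (intro choice allI dual_bound \<eta>)
    then obtain B where B: "\<And>n v. v \<in> vecs E \<Longrightarrow> norm (\<eta> n v) \<le> B n * nrm E v"
      by blast
    have "nrm E (combination (?J v) A) \<le> (\<Sum>n\<in>A. B n * nrm E (\<xi> n)) * nrm E v" if "v \<in> vecs E" for v
    proof -
      have "nrm E (combination (?J v) A) \<le> (\<Sum>n\<in>A. norm (\<eta> n v) * nrm E (\<xi> n))"
        unfolding combination_def using nrm_sum[of A "\<lambda>n. smul E (\<eta> n v) (\<xi> n)"] by simp
      also have "\<dots> \<le> (\<Sum>n\<in>A. (B n * nrm E v) * nrm E (\<xi> n))"
        by (intro sum_mono mult_right_mono B that) simp
      finally show ?thesis
        by (simp add: sum_distrib_left mult_ac)
    qed
    then show ?thesis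
      unfolding T_eq bounded_operator_def using combination_J_add combination_J_smul by auto
  qed
  have "\<exists>B. \<forall>T\<in>?T. nrm E (T v) \<le> B" if "v \<in> vecs E" for v
    using combination_le[OF J[OF that]] by blast
  then obtain C where C: "\<forall>T\<in>?T. \<forall>v\<in>vecs E. nrm E (T v) \<le> C * nrm E v"
    using uniform_boundedness[where \<T> = ?T, OF banach_nspace_axioms normed_nspace_axioms T] by auto
  have "nrm W (?J v) \<le> C * nrm E v" if "v \<in> vecs E" for v
    by (intro nrm_W_le) (use C that in auto)
  then show ?thesis
    unfolding bounded_operator_def using J
    by (auto simp: smul_W fun_eq_iff dual_add dual_smul \<eta>)
qed

theorem besselian_frame_complemented_embedding:
  fixes E :: "('k::{real_normed_field,banach}, 'a::ab_group_add) nspace"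
  assumes E: "banach_space E" and wsc: "weakly_seq_complete E"
    and frame: "besselian_schauder_frame E I x y"
  shows "\<exists>(W :: ('k, nat \<Rightarrow> 'k) nspace) S. banach_space W \<and> (\<exists>J e. unconditional_schauder_basis W J e) \<and>
    complemented_subspace W S \<and> isometrically_isomorphic E (W\<lparr>vecs := S\<rparr>)"
proof (cases "vecs E = {0}")
  case True
  \<comment> \<open>The zero space has no nonzero vector with which to complete the frame, but it sits in every space with
    an unconditional basis; the coefficient space of the constant sequence 1 of scalars is one.\<close>
  have "nonzero_sequence (scalars :: ('k, 'k) nspace) (\<lambda>_. 1)"
    using banach_nspace_scalars by (simp add: nonzero_sequence_def nonzero_sequence_axioms_def scalars_def)
  then interpret \<K>: nonzero_sequence "scalars :: ('k, 'k) nspace" "\<lambda>_. 1" .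
  interpret E: banach_nspace E
    using E by (simp add: banach_space_iff)
  show ?thesis
  proof (rule isometric_renorming[OF _ \<K>.banach_W _ _ _ \<K>.unconditional_schauder_basis_unit_sequences])
    show "banach_nspace E" by unfold_locales
    show "bounded_operator E \<K>.W (\<lambda>_. 0)" "bounded_operator \<K>.W E (\<lambda>_. 0)"
      unfolding bounded_operator_def
      by (intro conjI exI[of _ 0]; simp add: image_subset_iff)+
  qed (use True in simp)
next
  case False
  interpret E: banach_nspace E
    using E by (simp add: banach_space_iff)
  obtain u where u: "u \<in> vecs E" "u \<noteq> 0"
    using False E.zero_vecs by blast
  obtain \<xi> \<eta> where \<xi>: "\<And>n. \<xi> n \<in> vecs E" "\<And>n. \<xi> n \<noteq> 0" and \<eta>: "\<And>n. \<eta> n \<in> dual E"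
    and lim: "\<And>v. v \<in> vecs E \<Longrightarrow> limitin (ntopology E) (\<lambda>m. \<Sum>n<m. smul E (\<eta> n v) (\<xi> n)) v sequentially"
    and wuc: "\<And>v f. v \<in> vecs E \<Longrightarrow> f \<in> dual E \<Longrightarrow> summable (\<lambda>n. norm (\<eta> n v) * norm (f (\<xi> n)))"
    by (rule E.besselian_schauder_frame_normalize[OF frame u]) blast
  interpret nonzero_sequence E \<xi>
    by unfold_locales (use \<xi> in auto)
  have J: "bounded_operator E W (\<lambda>v n. \<eta> n v)"
    by (rule embedding_into_unconditional_coefficients[OF nonzero_sequence_axioms wsc \<eta> lim wuc])
  show ?thesis
  proof (rule isometric_renorming[OF E.banach_nspace_axioms banach_W J bounded_operator_synthesis _
        unconditional_schauder_basis_unit_sequences])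
    fix v assume v: "v \<in> vecs E"
    then have "(\<lambda>n. \<eta> n v) \<in> vecs W"
      using J by (auto simp: bounded_operator_def)
    then show "synthesis (\<lambda>n. \<eta> n v) = v"
      by (rule synthesis_eqI) (simp add: combination_def lim[OF v])
  qed
qed

theorem theorem5p2:
  fixes E :: "(real, 'a::ab_group_add) nspace"
    and F :: "(complex, 'b::ab_group_add) nspace"
  shows
    "(banach_space E \<and> separable_space (ntopology E) \<and> weakly_seq_complete E \<and>
      (\<exists>I x y. besselian_schauder_frame E I x y)
      \<longrightarrow>
      (\<exists>(W :: (real, nat \<Rightarrow> real) nspace) S.
         banach_space W \<and> (\<exists>J e. unconditional_schauder_basis W J e) \<and>
         complemented_subspace W S \<and> isometrically_isomorphic E (W\<lparr>vecs := S\<rparr>)))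
     \<and>
     (banach_space F \<and> separable_space (ntopology F) \<and> weakly_seq_complete F \<and>
      (\<exists>I x y. besselian_schauder_frame F I x y)
      \<longrightarrow>
      (\<exists>(W :: (complex, nat \<Rightarrow> complex) nspace) S.
         banach_space W \<and> (\<exists>J e. unconditional_schauder_basis W J e) \<and>
         complemented_subspace W S \<and> isometrically_isomorphic F (W\<lparr>vecs := S\<rparr>)))"
proof (intro conjI impI)
  assume "banach_space E \<and> separable_space (ntopology E) \<and> weakly_seq_complete E \<and>
      (\<exists>I x y. besselian_schauder_frame E I x y)"
  then obtain I x y where "banach_space E" "weakly_seq_complete E" "besselian_schauder_frame E I x y"
    by blast
  then show "\<exists>(W :: (real, nat \<Rightarrow> real) nspace) S.
         banach_space W \<and> (\<exists>J e. unconditional_schauder_basis W J e) \<and>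
         complemented_subspace W S \<and> isometrically_isomorphic E (W\<lparr>vecs := S\<rparr>)"
    by (rule besselian_frame_complemented_embedding)
next
  assume "banach_space F \<and> separable_space (ntopology F) \<and> weakly_seq_complete F \<and>
      (\<exists>I x y. besselian_schauder_frame F I x y)"
  then obtain I x y where "banach_space F" "weakly_seq_complete F" "besselian_schauder_frame F I x y"
    by blast
  then show "\<exists>(W :: (complex, nat \<Rightarrow> complex) nspace) S.
         banach_space W \<and> (\<exists>J e. unconditional_schauder_basis W J e) \<and>
         complemented_subspace W S \<and> isometrically_isomorphic F (W\<lparr>vecs := S\<rparr>)"
    by (rule besselian_frame_complemented_embedding)
qed

end
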